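(* Let $S=\operatorname{diag}(M_{11},\dots,M_{N_{vi}N_{vi}})^{1/2}$ be the Jacobi preconditioner of the FVEM mass matrix $M$. Then $$\kappa(S^{-1}MS^{-1})\le\frac{1}{(m_1-m_2)(d+1)},$$ a bound independent of the mesh.
   Context: $\mathcal{T}_h$ is a simplicial mesh of a bounded polyhedral domain $\Omega\subset\mathbb{R}^d$ with interior vertices $P_1,\dots,P_{N_{vi}}$ and continuous piecewise linear nodal basis functions $\phi_j$. Dual mesh: for an element $K$ with barycentric coordinates $\lambda$, $K^*_P\cap K=\{x\in K:\lambda_P\ge\lambda_Q\ \forall Q\}$, $K^*_P$ their union. FVEM mass matrix $M=(M_{ij})_{i,j=1}^{N_{vi}}$, $M_{ij}=\int_{K^*_{P_i}}\phi_j\,dx$ (symmetric positive definite). $m_1=\frac{1}{(d+1)^3}\big(1+(d+1)\sum_{k=1}^d\frac1k\big)$, $m_2=\frac{1}{d(d+1)^3}\big(d^2+2d-(d+1)\sum_{k=1}^d\frac1k\big)$. $\kappa$ is the spectral condition number $\lambda_{\max}/\lambda_{\min}$. *)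

theory Defs
  imports "HOL-Analysis.Analysis"
begin

text \<open>Points of R^d are vectors of type real^'n, with d = CARD('n).
A simplex (element) K is represented by its finite set of d+1 affinely
independent vertices; the closed element is convex hull K.\<close>

definition is_simplex :: "(real^'n) set \<Rightarrow> bool" where
  "is_simplex K \<longleftrightarrow> finite K \<and> card K = CARD('n) + 1 \<and> \<not> affine_dependent K"

text \<open>Simplicial (conforming) mesh of the domain interior(union of elements):
finitely many nondegenerate simplices, any two closed elements meet in their
common (possibly empty) face, and the domain is connected (bounded and
polyhedral is automatic).\<close>

definition mesh_domain :: "(real^'n) set set \<Rightarrow> (real^'n) set" where
  "mesh_domain T = interior (\<Union>K\<in>T. convex hull K)"

definition simplicial_mesh :: "(real^'n) set set \<Rightarrow> bool" where
  "simplicial_mesh T \<longleftrightarrow> finite T \<and> T \<noteq> {} \<and> (\<forall>K\<in>T. is_simplex K)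
     \<and> (\<forall>K\<in>T. \<forall>K'\<in>T. convex hull K \<inter> convex hull K' = convex hull (K \<inter> K'))
     \<and> connected (mesh_domain T)"

definition bary :: "(real^'n) set \<Rightarrow> real^'n \<Rightarrow> real^'n \<Rightarrow> real" where
  "bary K P x = (THE u. (\<forall>v. v \<notin> K \<longrightarrow> u v = 0) \<and> sum u K = 1
                        \<and> (\<Sum>v\<in>K. u v *\<^sub>R v) = x) P"

definition interior_vertices :: "(real^'n) set set \<Rightarrow> (real^'n) set" where
  "interior_vertices T = {P \<in> \<Union>T. P \<in> mesh_domain T}"

definition hat :: "(real^'n) set set \<Rightarrow> real^'n \<Rightarrow> real^'n \<Rightarrow> real" where
  "hat T P x = (if \<exists>K\<in>T. P \<in> K \<and> x \<in> convex hull K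
                then bary (SOME K. K \<in> T \<and> P \<in> K \<and> x \<in> convex hull K) P x
                else 0)"

definition dual_cell :: "(real^'n) set set \<Rightarrow> real^'n \<Rightarrow> (real^'n) set" where
  "dual_cell T P = (\<Union>K\<in>{K\<in>T. P \<in> K}.
      {x \<in> convex hull K. \<forall>Q\<in>K. bary K Q x \<le> bary K P x})"

text \<open>FVEM mass matrix, indexed by the interior vertices themselves.\<close>

definition fvem_mass :: "(real^'n) set set \<Rightarrow> real^'n \<Rightarrow> real^'n \<Rightarrow> real" where
  "fvem_mass T P Q = integral (dual_cell T P) (hat T Q)"

definition jacobi_scaled :: "('a \<Rightarrow> 'a \<Rightarrow> real) \<Rightarrow> 'a \<Rightarrow> 'a \<Rightarrow> real" where
  "jacobi_scaled A i j = (1 / sqrt (A i i)) * A i j * (1 / sqrt (A j j))"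

definition eigenvalues_on :: "'a set \<Rightarrow> ('a \<Rightarrow> 'a \<Rightarrow> real) \<Rightarrow> real set" where
  "eigenvalues_on I A = {c. \<exists>v. (\<exists>i\<in>I. v i \<noteq> 0) \<and>
       (\<forall>i\<in>I. (\<Sum>j\<in>I. A i j * v j) = c * v i)}"

definition spectral_cond :: "'a set \<Rightarrow> ('a \<Rightarrow> 'a \<Rightarrow> real) \<Rightarrow> real" where
  "spectral_cond I A = Max (eigenvalues_on I A) / Min (eigenvalues_on I A)"

definition m1 :: "nat \<Rightarrow> real" where
  "m1 d = (1 / (real d + 1) ^ 3) * (1 + (real d + 1) * (\<Sum>k=1..d. 1 / real k))"

definition m2 :: "nat \<Rightarrow> real" where
  "m2 d = (1 / (real d * (real d + 1) ^ 3)) *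
          ((real d)\<^sup>2 + 2 * real d - (real d + 1) * (\<Sum>k=1..d. 1 / real k))"

end

theory Submission
  imports Defs "Jordan_Normal_Form.Spectral_Radius"
begin

text \<open>On one element \<open>K\<close> the local mass matrix is \<open>|K|\<close> times the matrix with \<open>m1\<close> on the diagonal and
  \<open>m2\<close> elsewhere. Indeed the vertex transpositions of \<open>K\<close> preserve volume, so the diagonal entries
  agree, the others agree, and each row sums to \<open>|K|/(d+1)\<close>; it remains to find the mean of the
  largest barycentric coordinate, which is that on a simplex of the barycentric subdivision, namely
  \<open>(1 + 1/2 + \<dots> + 1/(d+1))/(d+1)\<close>. Writing the quadratic form of \<open>M\<close> as a sum over elements, each local
  form lies between \<open>(m1 - m2)/m1\<close> and \<open>(m1 + d m2)/m1 = 1/((d+1) m1)\<close> times the form of its diagonal,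
  and so do all the eigenvalues of the scaled matrix.\<close>

text \<open>An affine map multiplies all integrals by one common factor. This factor is 1 when the
  map carries a simplex onto itself, and it cancels when only a mean is wanted, so the geometric
  averages come from symmetry alone. The matrix is indexed by interior vertices only, so an element
  at the boundary contributes a principal submatrix of its local matrix; the bounds survive this
  because \<open>m2\<close> is nonnegative and an element has at most d + 1 vertices in the index
  set. The factor \<open>1 / m1\<close> is common to both bounds and drops out of their quotient.
  The condition number is a quotient of \<open>Max\<close> and \<open>Min\<close> over a set of real
  eigenvalues, so this set must first be shown finite and nonempty.\<close>

subsection \<open>Real eigenvalues of symmetric matrices\<close>

text \<open>The matrix is read as a complex one, whose spectrum is finite and nonempty. Each real
  eigenvalue is a complex one, hence finiteness. For existence, symmetry makes a complex eigenvalue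
  real, and then the real or the imaginary part of its eigenvector is a real eigenvector.\<close>

lemma
  fixes A :: "'a \<Rightarrow> 'a \<Rightarrow> real"
  assumes fin: "finite I"
  shows finite_eigenvalues_on: "finite (eigenvalues_on I A)"
    and eigenvalues_on_nonempty: "\<lbrakk>I \<noteq> {}; \<And>i j. i \<in> I \<Longrightarrow> j \<in> I \<Longrightarrow> A i j = A j i\<rbrakk> \<Longrightarrow> eigenvalues_on I A \<noteq> {}"
proof -
  obtain e where e: "bij_betw e {0..<card I} I"
    using ex_bij_betw_nat_finite[OF fin] by blast
  define n where "n = card I"
  have e: "bij_betw e {0..<n} I" using e by (simp add: n_def)
  define B where "B = Matrix.mat n n (\<lambda>(i,j). complex_of_real (A (e i) (e j)))"
  have B: "B \<in> carrier_mat n n" by (simp add: B_def)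
  have reindex: "(\<Sum>j\<in>I. f j) = (\<Sum>j<n. f (e j))" for f :: "'a \<Rightarrow> complex"
    using sum.reindex_bij_betw[OF e, of f] by (simp add: atLeast0LessThan)
  have Bv: "vec_index (mult_mat_vec B v) i = (\<Sum>j<n. complex_of_real (A (e i) (e j)) * vec_index v j)"
    if "i < n" "v \<in> carrier_vec n" for i v
    using that by (simp add: B_def scalar_prod_def atLeast0LessThan)
  have sub: "complex_of_real ` eigenvalues_on I A \<subseteq> spectrum B"
  proof safe
    fix c assume "c \<in> eigenvalues_on I A"
    then obtain v where v: "\<exists>i\<in>I. v i \<noteq> 0" "\<forall>i\<in>I. (\<Sum>j\<in>I. A i j * v j) = c * v i"
      by (auto simp: eigenvalues_on_def)
    define w where "w = Matrix.vec n (\<lambda>i. complex_of_real (v (e i)))"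
    have w: "w \<in> carrier_vec n" by (simp add: w_def)
    have "mult_mat_vec B w = complex_of_real c \<cdot>\<^sub>v w"
    proof (rule eq_vecI)
      show "dim_vec (mult_mat_vec B w) = dim_vec (complex_of_real c \<cdot>\<^sub>v w)"
        by (simp add: w_def B_def)
      fix i assume "i < dim_vec (complex_of_real c \<cdot>\<^sub>v w)"
      then have i: "i < n" by (simp add: w_def)
      then have ei: "e i \<in> I" using e by (auto simp: bij_betw_def)
      have "vec_index (mult_mat_vec B w) i = (\<Sum>j<n. complex_of_real (A (e i) (e j)) * complex_of_real (v (e j)))"
        by (subst Bv[OF i w]) (auto simp: w_def intro!: sum.cong)
      also have "\<dots> = (\<Sum>j\<in>I. complex_of_real (A (e i) j * v j))"
        by (simp add: reindex)
      also have "\<dots> = complex_of_real (c * v (e i))"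
        using v(2) ei by (simp flip: of_real_sum of_real_mult)
      finally show "vec_index (mult_mat_vec B w) i = vec_index (complex_of_real c \<cdot>\<^sub>v w) i"
        using i by (simp add: w_def)
    qed
    moreover have "w \<noteq> 0\<^sub>v n"
    proof
      assume w0: "w = 0\<^sub>v n"
      from v(1) obtain i where i: "i < n" "v (e i) \<noteq> 0" using e by (auto simp: bij_betw_def)
      have "vec_index w i = 0" using i w0 by simp
      then show False using i by (simp add: w_def)
    qed
    ultimately show "complex_of_real c \<in> spectrum B"
      using w B by (auto simp: spectrum_def eigenvalue_def eigenvector_def)
  qed
  then have "finite (complex_of_real ` eigenvalues_on I A)"
    using card_finite_spectrum(1)[OF B] finite_subset by blast
  then show "finite (eigenvalues_on I A)"
    by (rule finite_imageD) (simp add: inj_on_def)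
  assume "I \<noteq> {}" and sym: "\<And>i j. i \<in> I \<Longrightarrow> j \<in> I \<Longrightarrow> A i j = A j i"
  then have "n > 0" using fin by (auto simp: n_def card_gt_0_iff)
  then obtain k where "k \<in> spectrum B" using spectrum_non_empty[OF B] by auto
  then obtain w where w: "w \<in> carrier_vec n" "w \<noteq> 0\<^sub>v n" "mult_mat_vec B w = k \<cdot>\<^sub>v w"
    using B by (auto simp: spectrum_def eigenvalue_def eigenvector_def)
  define f where "f = the_inv_into {0..<n} e"
  define u where "u x = vec_index w (f x)" for x
  have fe: "f (e i) = i" if "i < n" for i
    using that e by (auto simp: f_def bij_betw_def the_inv_into_f_f)
  have eig: "(\<Sum>j\<in>I. complex_of_real (A i j) * u j) = k * u i" if i: "i \<in> I" for i
  proof -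
    obtain p where p: "p < n" "i = e p" using i e by (auto simp: bij_betw_def)
    have "(\<Sum>j\<in>I. complex_of_real (A i j) * u j) = vec_index (mult_mat_vec B w) p"
      by (simp add: reindex Bv[OF p(1) w(1)] p(2) u_def fe)
    also have "\<dots> = k * u i"
      using w(1) p by (simp add: w(3) u_def fe)
    finally show ?thesis .
  qed
  obtain p where p: "p < n" "vec_index w p \<noteq> 0"
  proof -
    have "\<not> (\<forall>p<n. vec_index w p = 0)"
    proof
      assume "\<forall>p<n. vec_index w p = 0"
      then have "w = 0\<^sub>v n" using w(1) by (intro eq_vecI) auto
      then show False using w(2) by simp
    qed
    then show thesis using that by blast
  qed
  define i0 where "i0 = e p"
  have i0: "i0 \<in> I" "u i0 \<noteq> 0"
    using p e by (auto simp: i0_def u_def fe bij_betw_def)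
  \<comment> \<open>The Hermitian form at \<open>u\<close> is \<open>k\<close> times a positive
    number by the eigenvalue equation and its own conjugate by symmetry, so \<open>k\<close> is
    real.\<close>
  define q where "q = (\<Sum>i\<in>I. \<Sum>j\<in>I. cnj (u i) * complex_of_real (A i j) * u j)"
  have q1: "q = k * complex_of_real (\<Sum>i\<in>I. (cmod (u i))\<^sup>2)"
  proof -
    have "q = (\<Sum>i\<in>I. cnj (u i) * (\<Sum>j\<in>I. complex_of_real (A i j) * u j))"
      by (simp add: q_def sum_distrib_left mult.assoc)
    also have "\<dots> = (\<Sum>i\<in>I. k * complex_of_real ((cmod (u i))\<^sup>2))"
    proof (rule sum.cong[OF refl])
      fix i assume i: "i \<in> I"
      show "cnj (u i) * (\<Sum>j\<in>I. complex_of_real (A i j) * u j) = k * complex_of_real ((cmod (u i))\<^sup>2)"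
        unfolding eig[OF i] complex_norm_square[of "u i"] by (simp add: mult.commute mult.left_commute)
    qed
    finally show ?thesis by (simp add: sum_distrib_left)
  qed
  have q2: "cnj q = q"
  proof -
    have "cnj q = (\<Sum>i\<in>I. \<Sum>j\<in>I. u i * complex_of_real (A i j) * cnj (u j))"
      by (simp add: q_def)
    also have "\<dots> = (\<Sum>j\<in>I. \<Sum>i\<in>I. u i * complex_of_real (A i j) * cnj (u j))"
      by (rule sum.swap)
    also have "\<dots> = q"
      unfolding q_def by (intro sum.cong refl) (simp add: sym mult.commute mult.left_commute)
    finally show ?thesis .
  qed
  have pos: "(\<Sum>i\<in>I. (cmod (u i))\<^sup>2) > 0"
    using fin i0 by (intro sum_pos2[of I i0]) auto
  have "Im q = 0" using q2 by (simp add: complex_eq_iff)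
  then have "Im k = 0" using pos unfolding q1 by simp
  then obtain c where k: "k = complex_of_real c" by (metis complex_is_Real_iff Reals_cases)
  have re: "(\<Sum>j\<in>I. A i j * Re (u j)) = c * Re (u i)"
    and im: "(\<Sum>j\<in>I. A i j * Im (u j)) = c * Im (u i)" if "i \<in> I" for i
    using arg_cong[OF eig[OF that], of Re] arg_cong[OF eig[OF that], of Im] by (simp_all add: k)
  have "Re (u i0) \<noteq> 0 \<or> Im (u i0) \<noteq> 0" using i0(2) by (simp add: complex_eq_iff)
  then have "c \<in> eigenvalues_on I A"
  proof
    assume "Re (u i0) \<noteq> 0"
    then show ?thesis unfolding eigenvalues_on_def using re i0(1)
      by (intro CollectI exI[of _ "\<lambda>i. Re (u i)"]) auto
  next
    assume "Im (u i0) \<noteq> 0"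
    then show ?thesis unfolding eigenvalues_on_def using im i0(1)
      by (intro CollectI exI[of _ "\<lambda>i. Im (u i)"]) auto
  qed
  then show "eigenvalues_on I A \<noteq> {}" by blast
qed

subsection \<open>Affine change of variables\<close>

text \<open>The linear change of variables theorem of the library requires a well-ordered index type.
  Integrals over an arbitrary \<^typ>\<open>real^'n\<close> are transported to this one.\<close>

typedef 'a idx = "{..<CARD('a::finite)}"
  by (rule exI[of _ 0]) simp

instance idx :: (finite) finite
  by standard (metis (mono_tags) type_definition.univ type_definition_idx finite_imageI finite_lessThan)

lemma card_idx: "CARD('a::finite idx) = CARD('a)"
  using type_definition.card[OF type_definition_idx] by simp

instantiation idx :: (finite) linorder
begin
definition "i \<le> j \<longleftrightarrow> Rep_idx i \<le> Rep_idx j"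
definition "i < j \<longleftrightarrow> Rep_idx i < Rep_idx j"
instance
  by standard (auto simp: less_eq_idx_def less_idx_def Rep_idx_inject)
end

instance idx :: (finite) wellorder
proof (rule wf_wellorderI)
  have "{(x, y :: 'a idx). x < y} = inv_image less_than Rep_idx"
    by (auto simp: less_idx_def)
  then show "wf {(x, y :: 'a idx). x < y}" by simp
qed intro_classes

text \<open>Bridge from the gauge integral of the definitions to the Bochner integral over
  \<open>lborel\<close>, where image measures are available.\<close>

lemma compact_continuous_integral:
  fixes f :: "'a::euclidean_space \<Rightarrow> real"
  assumes "compact S" "continuous_on UNIV f"
  shows "f absolutely_integrable_on S" "integral S f = (LINT x|lborel. indicator S x *\<^sub>R f x)"
proof -
  have "set_integrable lborel S f"
    unfolding set_integrable_def
    using borel_integrable_compact[OF assms(1)] assms(2) continuous_on_subset by blast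
  then show "f absolutely_integrable_on S" "integral S f = (LINT x|lborel. indicator S x *\<^sub>R f x)"
    using set_borel_integral_eq_integral(2)[of S f]
    by (auto simp: set_integrable_def set_lebesgue_integral_def integrable_completion)
qed

lemma integral_image_distr_lborel:
  fixes E :: "'a::euclidean_space \<Rightarrow> 'b::euclidean_space"
  assumes S: "compact S" and g: "continuous_on UNIV (g :: 'b \<Rightarrow> real)"
    and inj: "inj E" and E: "continuous_on UNIV E"
    and distr: "distr lborel borel E = lborel"
  shows "integral (E ` S) g = integral S (g \<circ> E)"
proof -
  have c: "continuous_on UNIV (g \<circ> E)"
    using E g continuous_on_compose continuous_on_subset by blast
  have ES: "compact (E ` S)"
    using S E compact_continuous_image continuous_on_subset by blast
  have mE: "E \<in> measurable lborel borel"
    using borel_measurable_continuous_onI[OF E] by simp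
  have mg: "(\<lambda>x. indicator (E ` S) x *\<^sub>R g x) \<in> borel_measurable borel"
    using ES borel_measurable_continuous_onI[OF g] by (intro borel_measurable_scaleR borel_measurable_indicator) (auto intro: borel_compact)
  have "integral (E ` S) g = (LINT x|distr lborel borel E. indicator (E ` S) x *\<^sub>R g x)"
    by (simp add: distr compact_continuous_integral(2)[OF ES g])
  also have "\<dots> = (LINT x|lborel. indicator (E ` S) (E x) *\<^sub>R g (E x))"
    by (rule integral_distr[OF mE mg])
  also have "\<dots> = (LINT x|lborel. indicator S x *\<^sub>R (g \<circ> E) x)"
    using inj by (intro Bochner_Integration.integral_cong) (auto simp: indicator_def inj_def)
  finally show ?thesis
    by (simp add: compact_continuous_integral(2)[OF S c])
qed

text \<open>\<open>lborel\<close> is determined by its values on boxes, and relabelling coordinates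
  turns a box into one with the same side lengths in another order.\<close>

lemma distr_lborel_relabel:
  fixes \<phi> :: "'m::finite \<Rightarrow> 'n::finite"
  assumes "bij \<phi>"
  shows "distr lborel borel (\<lambda>x::real^'n. \<chi> i. x $ \<phi> i) = (lborel :: (real^'m) measure)"
proof (rule lborel_eqI[symmetric])
  let ?E = "\<lambda>x::real^'n. \<chi> i. x $ \<phi> i"
  define \<psi> where "\<psi> = inv_into UNIV \<phi>"
  have \<psi>: "\<phi> (\<psi> i) = i" "\<psi> (\<phi> j) = j" for i j
    using assms by (auto simp: \<psi>_def bij_def surj_f_inv_f)
  fix l u :: "real^'m" assume lu: "\<And>b. b \<in> Basis \<Longrightarrow> l \<bullet> b \<le> u \<bullet> b"
  have le: "l $ i \<le> u $ i" for i
    using lu[of "axis i 1"] by (simp add: inner_axis axis_in_Basis_iff)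
  let ?l = "\<chi> j. l $ \<psi> j :: real^'n" and ?u = "\<chi> j. u $ \<psi> j :: real^'n"
  have m: "?E \<in> measurable lborel borel"
    by (simp add: borel_measurable_continuous_onI continuous_on_vec_lambda continuous_on_component)
  have "emeasure (distr lborel borel ?E) (box l u) = emeasure lborel (?E -` box l u)"
    using m by (simp add: emeasure_distr)
  also have "?E -` box l u = box ?l ?u"
    by (auto simp: mem_box_cart) (metis \<psi>)+
  also have "emeasure lborel (box ?l ?u) = (\<Prod>b\<in>Basis. (?u - ?l) \<bullet> b)"
    using le by (subst emeasure_lborel_box) (auto simp: Basis_vec_def inner_axis)
  also have "(\<Prod>b\<in>Basis. (?u - ?l) \<bullet> b) = (\<Prod>j\<in>UNIV. u $ \<psi> j - l $ \<psi> j)"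
    by (simp add: Basis_vec_def UNION_singleton_eq_range prod.reindex inj_on_def axis_eq_axis inner_axis)
  also have "\<dots> = (\<Prod>i\<in>UNIV. u $ i - l $ i)"
    by (rule prod.reindex_bij_witness[of _ \<phi> \<psi>]) (auto simp: \<psi>)
  also have "\<dots> = (\<Prod>b\<in>Basis. (u - l) \<bullet> b)"
    by (simp add: Basis_vec_def UNION_singleton_eq_range prod.reindex inj_on_def axis_eq_axis inner_axis)
  finally show "emeasure (distr lborel borel ?E) (box l u) = (\<Prod>b\<in>Basis. (u - l) \<bullet> b)" .
qed simp

lemma integral_linear_image_wellorder:
  fixes L :: "real^'m::{finite,wellorder} \<Rightarrow> real^'m::_"
  assumes L: "linear L" and S: "compact S" and g: "continuous_on UNIV (g :: _ \<Rightarrow> real)"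
  shows "integral (L ` S) g = \<bar>Determinants.det (matrix L)\<bar> * integral S (g \<circ> L)"
proof -
  \<comment> \<open>The linear change of variables is stated for vector-valued integrands, so
    \<open>g\<close> is viewed as a function into \<open>real^1\<close>.\<close>
  define f :: "real^'m::_ \<Rightarrow> real^1" where "f x = (\<chi> i. g x)" for x
  have cL: "continuous_on UNIV L" using L linear_continuous_on linear_conv_bounded_linear by blast
  have LS: "compact (L ` S)" using S cL compact_continuous_image continuous_on_subset by blast
  have c: "continuous_on UNIV (g \<circ> L)" using cL g continuous_on_compose continuous_on_subset by blast
  have vec: "f absolutely_integrable_on (L ` S)" "(f \<circ> L) absolutely_integrable_on S"
  proof -
    have fb: "(\<lambda>x. f x \<bullet> b) = g" "(\<lambda>x. (f \<circ> L) x \<bullet> b) = g \<circ> L" if "b \<in> Basis" for b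
      using that by (auto simp: f_def Basis_vec_def inner_axis fun_eq_iff)
    show "f absolutely_integrable_on (L ` S)"
      by (rule absolutely_integrable_componentwise)
        (simp only: fb compact_continuous_integral(1)[OF LS g])
    show "(f \<circ> L) absolutely_integrable_on S"
      by (rule absolutely_integrable_componentwise)
        (simp only: fb compact_continuous_integral(1)[OF S c])
  qed
  have "integral (L ` S) f $ 1 = (\<bar>Determinants.det (matrix L)\<bar> *\<^sub>R integral S (f \<circ> L)) $ 1"
    by (simp only: integral_change_of_variables_linear[OF L disjI1[OF vec(1)]])
  moreover have "integral (L ` S) f $ 1 = integral (L ` S) g"
    using integral_component_eq_cart[of f "L ` S" 1] vec by (simp add: f_def set_lebesgue_integral_eq_integral(1))
  moreover have "integral S (f \<circ> L) $ 1 = integral S (g \<circ> L)"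
    using integral_component_eq_cart[of "f \<circ> L" S 1] vec by (simp add: f_def o_def set_lebesgue_integral_eq_integral(1))
  ultimately show ?thesis by simp
qed

text \<open>The factor \<open>k\<close> is the same for all sets and integrands, so it can be read
  off from one known integral or eliminated from a quotient of two.\<close>

definition scales_integral :: "real \<Rightarrow> ('a::euclidean_space \<Rightarrow> 'a) \<Rightarrow> bool" where
  "scales_integral k F \<longleftrightarrow> (\<forall>S g. compact S \<longrightarrow> continuous_on UNIV (g :: _ \<Rightarrow> real) \<longrightarrow>
     integral (F ` S) g = k * integral S (\<lambda>x. g (F x)))"

lemma scales_integralD:
  "\<lbrakk>scales_integral k F; compact S; continuous_on UNIV g\<rbrakk> \<Longrightarrow>
     integral (F ` S) g = k * integral S (\<lambda>x. g (F x))"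
  by (simp add: scales_integral_def)

text \<open>The map is a translation after \<open>E' \<circ> L' \<circ> E\<close>. The translation
  and the relabellings \<open>E\<close>, \<open>E'\<close> preserve Lebesgue measure, so the factor
  is that of \<open>L'\<close>, the absolute value of its determinant.\<close>

lemma integral_affine_image:
  fixes L :: "real^'n \<Rightarrow> real^'n"
  assumes L: "linear L"
  shows "\<exists>k. scales_integral k (\<lambda>x. c + L x)"
proof -
  obtain \<phi> :: "'n idx \<Rightarrow> 'n" where \<phi>: "bij \<phi>"
    using finite_same_card_bij[of "UNIV :: 'n idx set" "UNIV :: 'n set"] card_idx[where 'a='n] by auto
  define \<psi> where "\<psi> = inv_into UNIV \<phi>"
  have b\<psi>: "bij \<psi>" using \<phi> by (simp add: \<psi>_def bij_imp_bij_inv)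
  have \<psi>: "\<phi> (\<psi> i) = i" "\<psi> (\<phi> j) = j" for i j
    using \<phi> by (auto simp: \<psi>_def bij_def surj_f_inv_f)
  define E where "E = (\<lambda>x::real^'n. (\<chi> i. x $ \<phi> i) :: real^'n idx)"
  define E' where "E' = (\<lambda>x::real^'n idx. (\<chi> i. x $ \<psi> i) :: real^'n)"
  have EE': "E' (E x) = x" "E (E' y) = y" for x y
    by (simp_all add: E_def E'_def \<psi>)
  have linE: "linear E" "linear E'"
    by (auto simp: E_def E'_def linear_iff Finite_Cartesian_Product.vec_eq_iff)
  have cont: "continuous_on UNIV h" if "linear h" for h :: "'x::euclidean_space \<Rightarrow> 'y::euclidean_space"
    using that linear_continuous_on linear_conv_bounded_linear by blast
  have dE: "distr lborel borel E = lborel" "distr lborel borel E' = lborel"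
    unfolding E_def E'_def using \<phi> b\<psi> distr_lborel_relabel by blast+
  have injE: "inj E" "inj E'" by (metis EE' injI)+
  define L' where "L' = E \<circ> L \<circ> E'"
  have L': "linear L'" unfolding L'_def using linE L by (intro linear_compose)
  have "integral ((\<lambda>x. c + L x) ` S) g = \<bar>Determinants.det (matrix L')\<bar> * integral S (\<lambda>x. g (c + L x))"
    if S: "compact S" and g: "continuous_on UNIV (g :: _ \<Rightarrow> real)" for S g
  proof -
    have comp: "continuous_on UNIV (q \<circ> p)" if "continuous_on UNIV q" "continuous_on UNIV p"
      for p :: "'x::euclidean_space \<Rightarrow> 'y::euclidean_space" and q :: "'y \<Rightarrow> real"
      using that continuous_on_compose continuous_on_subset by blast
    have plus: "continuous_on UNIV ((+) c)" by (intro continuous_intros)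
    let ?g = "g \<circ> (+) c"
    have gc: "continuous_on UNIV ?g"
      by (rule comp[OF g plus])
    have ci: "compact (h ` A)" if "linear h" "compact A" for A and h :: "'x::euclidean_space \<Rightarrow> 'y::euclidean_space"
      using that cont compact_continuous_image continuous_on_subset by blast
    have gE: "continuous_on UNIV (?g \<circ> E')"
      by (rule comp[OF gc cont[OF linE(2)]])
    have gEL: "continuous_on UNIV (?g \<circ> E' \<circ> L')"
      by (rule comp[OF gE cont[OF L']])
    have LS: "E' ` (L' ` (E ` S)) = L ` S"
      by (simp add: L'_def image_comp EE' o_def)
    have "integral ((\<lambda>x. c + L x) ` S) g = integral ((+) c ` (L ` S)) g"
      by (simp add: image_comp o_def)
    also have "\<dots> = integral (L ` S) ?g"
      by (rule integral_image_distr_lborel[OF ci[OF L S] g _ plus lborel_distr_plus]) simp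
    also have "\<dots> = integral (L' ` (E ` S)) (?g \<circ> E')"
      unfolding LS[symmetric]
      by (rule integral_image_distr_lborel[OF ci[OF L' ci[OF linE(1) S]] gc injE(2) cont[OF linE(2)] dE(2)])
    also have "\<dots> = \<bar>Determinants.det (matrix L')\<bar> * integral (E ` S) (?g \<circ> E' \<circ> L')"
      by (rule integral_linear_image_wellorder[OF L' _ gE]) (rule ci[OF linE(1) S])
    also have "integral (E ` S) (?g \<circ> E' \<circ> L') = integral S (?g \<circ> E' \<circ> L' \<circ> E)"
      by (rule integral_image_distr_lborel[OF S gEL injE(1) cont[OF linE(1)] dE(1)])
    also have "?g \<circ> E' \<circ> L' \<circ> E = (\<lambda>x. g (c + L x))"
      by (simp add: fun_eq_iff L'_def EE')
    finally show ?thesis .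
  qed
  then show ?thesis unfolding scales_integral_def by blast
qed

subsection \<open>Barycentric coordinates\<close>

text \<open>Affine independence makes the weights unique on \<open>K\<close>. The definite
  description also demands zeros off \<open>K\<close>, hence the extension \<open>?u\<close> in the
  proof.\<close>

lemma bary_eqI:
  assumes K: "is_simplex K" and u: "sum u K = 1" "(\<Sum>v\<in>K. u v *\<^sub>R v) = x" and P: "P \<in> K"
  shows "bary K P x = u P"
proof -
  have fin: "finite K" and ind: "\<not> affine_dependent K" using K by (auto simp: is_simplex_def)
  let ?u = "\<lambda>v. if v \<in> K then u v else 0"
  have "(THE u. (\<forall>v. v \<notin> K \<longrightarrow> u v = 0) \<and> sum u K = 1 \<and> (\<Sum>v\<in>K. u v *\<^sub>R v) = x) = ?u"
  proof (rule the_equality)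
    show "(\<forall>v. v \<notin> K \<longrightarrow> ?u v = 0) \<and> sum ?u K = 1 \<and> (\<Sum>v\<in>K. ?u v *\<^sub>R v) = x"
      using u by (auto cong: sum.cong)
    fix w assume w: "(\<forall>v. v \<notin> K \<longrightarrow> w v = 0) \<and> sum w K = 1 \<and> (\<Sum>v\<in>K. w v *\<^sub>R v) = x"
    have "sum (\<lambda>v. w v - u v) K = 0" "(\<Sum>v\<in>K. (w v - u v) *\<^sub>R v) = 0"
      using w u by (simp_all add: sum_subtractf algebra_simps)
    then have "\<forall>v\<in>K. w v - u v = 0"
      using ind affine_dependent_explicit_finite[OF fin] by blast
    then show "w = ?u" using w by (auto simp: fun_eq_iff)
  qed
  then show ?thesis using P by (simp add: bary_def)
qed

text \<open>In dimension d, d + 1 affinely independent points span the whole space affinely, so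
  coordinates exist outside the simplex as well.\<close>

lemma bary_sum:
  fixes K :: "(real^'n) set"
  assumes K: "is_simplex K"
  shows "(\<Sum>v\<in>K. bary K v x) = 1" "(\<Sum>v\<in>K. bary K v x *\<^sub>R v) = x"
proof -
  have "affine hull K = UNIV"
    using K by (intro affine_independent_span_eq) (auto simp: is_simplex_def)
  then have "x \<in> affine hull K" by simp
  then obtain u where u: "sum u K = 1" "(\<Sum>v\<in>K. u v *\<^sub>R v) = x"
    using K by (auto simp: affine_hull_finite is_simplex_def)
  then have "bary K v x = u v" if "v \<in> K" for v using bary_eqI[OF K] that by blast
  then show "(\<Sum>v\<in>K. bary K v x) = 1" "(\<Sum>v\<in>K. bary K v x *\<^sub>R v) = x"
    using u by (auto cong: sum.cong)
qed

lemma bary_vertex: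
  assumes K: "is_simplex K" and "P \<in> K" "Q \<in> K"
  shows "bary K P Q = (if P = Q then 1 else 0)"
proof -
  have "finite K" using K by (simp add: is_simplex_def)
  then show ?thesis
    using assms by (intro bary_eqI[where u="\<lambda>v. if v = Q then 1 else 0"])
      (auto simp: if_distrib[of "\<lambda>r. r *\<^sub>R _"] cong: if_cong)
qed

text \<open>In this form a coordinate is visibly continuous and its level sets are hyperplanes. The
  vector \<open>a\<close> represents the linear part through the adjoint.\<close>

lemma bary_inner_form:
  fixes K :: "(real^'n) set"
  assumes K: "is_simplex K" and P: "P \<in> K"
  obtains a c where "\<And>x. bary K P x = a \<bullet> x + c"
proof -
  define f where "f x = bary K P x - bary K P 0" for x
  have "linear f"
  proof (rule linearI)
    fix x y r
    \<comment> \<open>The coefficients \<open>1 + 1 - 1\<close> here and \<open>r + (1 - r)\<close>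
      below have total one, so the combined weights still sum to 1; the coordinates of the origin
      add nothing to the point.\<close>
    have "bary K P (x + y) = bary K P x + bary K P y - bary K P 0"
      using bary_sum[OF K] by (intro bary_eqI[OF K _ _ P])
        (simp_all add: sum.distrib sum_subtractf scaleR_add_left scaleR_diff_left)
    then show "f (x + y) = f x + f y" by (simp add: f_def)
    have "bary K P (r *\<^sub>R x) = r * bary K P x + (1 - r) * bary K P 0"
      using bary_sum[OF K] by (intro bary_eqI[OF K _ _ P])
        (simp_all add: sum.distrib scaleR_add_left flip: sum_distrib_left scaleR_scaleR scaleR_sum_right)
    then show "f (r *\<^sub>R x) = r *\<^sub>R f x" by (simp add: f_def algebra_simps)
  qed
  then have "x \<bullet> adjoint f 1 = f x" for x
    using adjoint_works[of f x 1] by simp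
  then have "bary K P x = adjoint f 1 \<bullet> x + bary K P 0" for x
    unfolding inner_commute[of "adjoint f 1"] by (simp only:) (simp add: f_def)
  then show ?thesis by (rule that)
qed

lemma bary_affine_combination:
  assumes K: "is_simplex K" and P: "P \<in> K" and w: "sum w I = 1"
  shows "bary K P (\<Sum>i\<in>I. w i *\<^sub>R p i) = (\<Sum>i\<in>I. w i * bary K P (p i))"
proof -
  obtain a c where ac: "\<And>x. bary K P x = a \<bullet> x + c" using bary_inner_form[OF K P] by blast
  show ?thesis using w
    by (simp add: ac inner_sum_right distrib_left sum.distrib flip: sum_distrib_right)
qed

lemma continuous_on_bary:
  assumes "is_simplex K" "P \<in> K"
  shows "continuous_on S (bary K P)"
proof -
  obtain a c where "\<And>x. bary K P x = a \<bullet> x + c" using bary_inner_form[OF assms] by blast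
  then have "bary K P = (\<lambda>x. a \<bullet> x + c)" by auto
  then show ?thesis by (simp add: continuous_intros)
qed

lemma negligible_bary_level:
  assumes K: "is_simplex K" and P: "P \<in> K"
  shows "negligible {x. bary K P x = 0}"
    and "\<lbrakk>Q \<in> K; P \<noteq> Q\<rbrakk> \<Longrightarrow> negligible {x. bary K P x = bary K Q x}"
proof -
  obtain a c where ac: "\<And>x. bary K P x = a \<bullet> x + c" using bary_inner_form[OF K P] by blast
  \<comment> \<open>Excludes the degenerate equation \<open>0 = 0\<close>: at the vertex
    \<open>P\<close> the coordinate is 1.\<close>
  have "a \<noteq> 0 \<or> - c \<noteq> 0" using ac[of P] by (auto simp: bary_vertex[OF K P P])
  moreover have "{x. bary K P x = 0} = {x. a \<bullet> x = - c}" by (auto simp: ac)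
  ultimately show "negligible {x. bary K P x = 0}" using negligible_hyperplane by metis
  assume Q: "Q \<in> K" "P \<noteq> Q"
  obtain b e where be: "\<And>x. bary K Q x = b \<bullet> x + e" using bary_inner_form[OF K Q(1)] by blast
  have "a - b \<noteq> 0 \<or> e - c \<noteq> 0"
    using ac[of P] be[of P] Q P by (auto simp: bary_vertex[OF K])
  moreover have "{x. bary K P x = bary K Q x} = {x. (a - b) \<bullet> x = e - c}"
    by (auto simp: ac be inner_diff_left)
  ultimately show "negligible {x. bary K P x = bary K Q x}" using negligible_hyperplane by metis
qed

lemma convex_hull_iff_bary:
  assumes K: "is_simplex K"
  shows "x \<in> convex hull K \<longleftrightarrow> (\<forall>P\<in>K. 0 \<le> bary K P x)"
proof
  have fin: "finite K" using K by (simp add: is_simplex_def)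
  show "\<forall>P\<in>K. 0 \<le> bary K P x" if "x \<in> convex hull K"
    using that bary_eqI[OF K] by (auto simp: convex_hull_finite[OF fin])
  show "x \<in> convex hull K" if "\<forall>P\<in>K. 0 \<le> bary K P x"
    using that bary_sum[OF K, of x] by (auto simp: convex_hull_finite[OF fin])
qed

lemma compact_simplex: "is_simplex K \<Longrightarrow> compact (convex hull K)"
  by (simp add: is_simplex_def finite_imp_compact_convex_hull)

lemma bary_determines:
  assumes "is_simplex K" "\<And>P. P \<in> K \<Longrightarrow> bary K P x = bary K P y"
  shows "x = y"
proof -
  have "x = (\<Sum>v\<in>K. bary K v x *\<^sub>R v)" using bary_sum[OF assms(1)] by simp
  also have "\<dots> = (\<Sum>v\<in>K. bary K v y *\<^sub>R v)" using assms(2) by simp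
  finally show ?thesis using bary_sum[OF assms(1)] by simp
qed

section \<open>Volume of an element and affine maps given by vertex values\<close>

definition simplex_volume :: "(real^'n) set \<Rightarrow> real" where
  "simplex_volume K = integral (convex hull K) (\<lambda>_. 1)"

lemma simplex_volume_pos:
  fixes K :: "(real^'n) set"
  assumes K: "is_simplex K"
  shows "simplex_volume K > 0"
proof -
  have c: "compact (convex hull K)" by (rule compact_simplex[OF K])
  have m: "convex hull K \<in> lmeasurable" using c by (rule lmeasurable_compact)
  have "interior (convex hull K) \<noteq> {}"
    using K interior_convex_hull_eq_empty[of K] by (auto simp: is_simplex_def)
  then have "\<not> negligible (convex hull K)"
    using negligible_convex_interior convex_convex_hull by blast
  then have "measure lebesgue (convex hull K) \<noteq> 0"
    using m negligible_iff_measure by blast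
  then show ?thesis
    using measure_nonneg[of lebesgue "convex hull K"] lmeasure_integral[OF m] by (simp add: simplex_volume_def)
qed

text \<open>The formula for \<open>F\<close> is the affine map that takes each vertex
  \<open>v\<close> to \<open>p v\<close>; subtracting its value at the origin leaves a linear
  map.\<close>

lemma integral_simplex_map:
  fixes K :: "(real^'n) set" and p :: "real^'n \<Rightarrow> real^'n"
  assumes K: "is_simplex K"
  defines "F \<equiv> \<lambda>x. \<Sum>v\<in>K. bary K v x *\<^sub>R p v"
  shows "\<exists>k. scales_integral k F"
proof -
  have "linear (\<lambda>x. bary K v x - bary K v 0)" if v: "v \<in> K" for v
  proof -
    obtain a c where "\<And>x. bary K v x = a \<bullet> x + c" using bary_inner_form[OF K v] by blast
    then show ?thesis by (auto intro!: linearI simp: inner_add_right)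
  qed
  then have lin: "linear (\<lambda>x. \<Sum>v\<in>K. (bary K v x - bary K v 0) *\<^sub>R p v)"
    by (intro linear_compose_sum ballI linear_compose[of "\<lambda>x. bary K _ x - bary K _ 0" "\<lambda>r. r *\<^sub>R p _", unfolded o_def])
      (auto intro!: linearI simp: scaleR_add_left)
  have "\<exists>k. scales_integral k (\<lambda>x. F 0 + (\<Sum>v\<in>K. (bary K v x - bary K v 0) *\<^sub>R p v))"
    using integral_affine_image[OF lin, of "F 0"] .
  moreover have "F 0 + (\<Sum>v\<in>K. (bary K v x - bary K v 0) *\<^sub>R p v) = F x" for x
    by (simp add: F_def scaleR_diff_left sum_subtractf)
  ultimately show ?thesis by simp
qed

text \<open>The affine map exchanging the two vertices sends the simplex onto itself, so comparing
  volumes forces its factor to be 1.\<close>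

lemma simplex_transposition:
  fixes K :: "(real^'n) set"
  assumes K: "is_simplex K" and P: "P \<in> K" and Q: "Q \<in> K"
  shows "\<exists>F. (\<forall>V\<in>K. \<forall>x. bary K V (F x) = bary K (Transposition.transpose P Q V) x)
    \<and> (\<forall>x. F (F x) = x) \<and> scales_integral 1 F"
proof -
  let ?t = "Transposition.transpose P Q"
  have fin: "finite K" using K by (simp add: is_simplex_def)
  have tK: "?t v \<in> K" if "v \<in> K" for v
    using that P Q by (auto simp: Transposition.transpose_def)
  define F where "F x = (\<Sum>v\<in>K. bary K v x *\<^sub>R ?t v)" for x
  obtain k where k: "scales_integral k F"
    using integral_simplex_map[OF K, of ?t, folded F_def] ..
  have bF: "bary K V (F x) = bary K (?t V) x" if V: "V \<in> K" for V x
  proof -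
    have "bary K V (F x) = (\<Sum>v\<in>K. bary K v x * bary K V (?t v))"
      unfolding F_def by (rule bary_affine_combination[OF K V bary_sum(1)[OF K]])
    also have "\<dots> = (\<Sum>v\<in>K. if v = ?t V then bary K v x else 0)"
      by (rule sum.cong) (auto simp: bary_vertex[OF K V tK])
    finally show ?thesis using fin tK[OF V] by simp
  qed
  have FF: "F (F x) = x" for x
    by (rule bary_determines[OF K]) (simp add: bF tK)
  have hull: "F ` (convex hull K) = convex hull K"
  proof -
    have "F x \<in> convex hull K" if "x \<in> convex hull K" for x
      using that tK by (simp add: convex_hull_iff_bary[OF K] bF)
    then show ?thesis using FF by (auto simp: image_iff) metis
  qed
  have "simplex_volume K = k * simplex_volume K"
    using scales_integralD[OF k compact_simplex[OF K], of "\<lambda>_. 1"] by (simp add: hull simplex_volume_def)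
  then have "k = 1" using simplex_volume_pos[OF K] by simp
  then have "scales_integral 1 F" using k by simp
  with bF FF show ?thesis by blast
qed

subsection \<open>Ordering the barycentric coordinates\<close>

text \<open>The numbering is kept arbitrary so that any vertex can receive index 0 when its cell is
  studied.\<close>

locale enumerated_simplex =
  fixes K :: "(real^'n) set" and e :: "nat \<Rightarrow> real^'n" and d :: nat
  assumes simplex: "is_simplex K" and enum: "bij_betw e {..d} K"
begin

definition b :: "nat \<Rightarrow> real^'n \<Rightarrow> real" where "b m = bary K (e m)"

text \<open>The points of the simplex whose \<open>j\<close> largest barycentric coordinates are, in this order,
  those of \<open>e 0, \<dots>, e (j - 1)\<close>: \<open>R 1\<close> is a piece of a dual cell, and \<open>R (Suc d)\<close> is one simplex
  of the barycentric subdivision.\<close>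

definition R :: "nat \<Rightarrow> (real^'n) set" where
  "R j = {x \<in> convex hull K. \<forall>i<j. \<forall>m\<in>{i..d}. b m x \<le> b i x}"

lemma e_in: "m \<le> d \<Longrightarrow> e m \<in> K"
  using enum by (auto simp: bij_betw_def)

lemma e_eq_iff: "\<lbrakk>i \<le> d; m \<le> d\<rbrakk> \<Longrightarrow> e i = e m \<longleftrightarrow> i = m"
  using enum by (auto simp: bij_betw_def inj_on_def)

lemma sum_K: "(\<Sum>v\<in>K. f v) = (\<Sum>m\<le>d. f (e m))"
  using sum.reindex_bij_betw[OF enum, of f] by simp

lemma ball_K: "(\<forall>v\<in>K. Pr v) \<longleftrightarrow> (\<forall>m\<le>d. Pr (e m))"
  using enum by (auto simp: bij_betw_def)

lemma sum_b: "(\<Sum>m\<le>d. b m x) = 1"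
  using bary_sum(1)[OF simplex, of x] by (simp add: sum_K b_def)

lemma b_determines:
  assumes "\<And>m. m \<le> d \<Longrightarrow> b m x = b m y"
  shows "x = y"
proof (rule bary_determines[OF simplex])
  fix P assume "P \<in> K"
  then obtain m where "m \<le> d" "P = e m" using enum by (auto simp: bij_betw_def)
  then show "bary K P x = bary K P y" using assms[of m] by (simp add: b_def)
qed

lemma hull_iff: "x \<in> convex hull K \<longleftrightarrow> (\<forall>m\<le>d. 0 \<le> b m x)"
  using convex_hull_iff_bary[OF simplex, of x] by (simp add: ball_K b_def)

lemma cont_b: "m \<le> d \<Longrightarrow> continuous_on S (b m)"
  unfolding b_def by (rule continuous_on_bary[OF simplex e_in])

lemma R_0: "R 0 = convex hull K" by (simp add: R_def)

lemma R_Suc: "R (Suc j) = {x \<in> R j. \<forall>m\<in>{j..d}. b m x \<le> b j x}"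
  by (auto simp: R_def less_Suc_eq)

lemma compact_Int_le:
  assumes "compact S" "\<And>m. m \<in> A \<Longrightarrow> m \<le> d" "q \<le> d"
  shows "compact {x \<in> S. \<forall>m\<in>A. b m x \<le> b q x}"
proof -
  have "{x \<in> S. \<forall>m\<in>A. b m x \<le> b q x} = S \<inter> (\<Inter>m\<in>A. {x. b m x \<le> b q x})" by auto
  moreover have "closed (\<Inter>m\<in>A. {x. b m x \<le> b q x})"
    using assms cont_b by (intro closed_INT ballI closed_Collect_le) auto
  ultimately show ?thesis using assms(1) by (simp add: compact_Int_closed)
qed

lemma compact_R: "j \<le> Suc d \<Longrightarrow> compact (R j)"
proof (induction j)
  case 0
  then show ?case by (simp add: R_0 compact_simplex[OF simplex])
next
  case (Suc j)
  then show ?case unfolding R_Suc by (intro compact_Int_le) auto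
qed

lemma index_transposition:
  assumes j: "j \<le> d" and q: "q \<le> d"
  shows "\<exists>F. (\<forall>m\<le>d. \<forall>x. b m (F x) = b (Transposition.transpose j q m) x)
    \<and> (\<forall>x. F (F x) = x) \<and> scales_integral 1 F"
proof -
  have tr: "e (Transposition.transpose j q m) = Transposition.transpose (e j) (e q) (e m)" if "m \<le> d" for m
  proof -
    consider "m = j" | "m = q" | "m \<noteq> j" "m \<noteq> q" by blast
    then show ?thesis
      using that j q by cases (simp_all add: e_eq_iff transpose_apply_other)
  qed
  obtain F where F: "\<forall>V\<in>K. \<forall>x. bary K V (F x) = bary K (Transposition.transpose (e j) (e q) V) x"
    "\<forall>x. F (F x) = x" "scales_integral 1 F"
    using simplex_transposition[OF simplex e_in[OF j] e_in[OF q]] by blast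
  have "b m (F x) = b (Transposition.transpose j q m) x" if "m \<le> d" for m x
    using F(1) e_in[OF that] by (simp add: b_def tr[OF that])
  with F show ?thesis by blast
qed

text \<open>\<open>R j\<close> is cut according to which index from \<open>j\<close> to
  \<open>d\<close> carries the largest coordinate. Transposing \<open>j\<close> and \<open>q\<close>
  leaves the indices below \<open>j\<close> in place, so it preserves \<open>R j\<close> and carries
  the piece of \<open>j\<close> onto that of \<open>q\<close>. For \<open>g = b 0\<close> the
  invariance requires \<open>j \<ge> 1\<close>, which is why means are compared from
  \<open>R 1\<close> on.\<close>

lemma integral_R_step:
  assumes j: "j \<le> d" and g: "continuous_on UNIV (g :: _ \<Rightarrow> real)"
    and inv: "\<And>q F x. \<lbrakk>j \<le> q; q \<le> d; \<And>m x. m \<le> d \<Longrightarrow> b m (F x) = b (Transposition.transpose j q m) x\<rbrakk> \<Longrightarrow> g (F x) = g x"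
  shows "integral (R j) g = (real d + 1 - real j) * integral (R (Suc j)) g"
proof -
  define C where "C q = {x \<in> R j. \<forall>m\<in>{j..d}. b m x \<le> b q x}" for q
  have cC: "compact (C q)" if "q \<in> {j..d}" for q
    unfolding C_def using that j by (intro compact_Int_le compact_R) auto
  have eq: "integral (C q) g = integral (C j) g" if q: "q \<in> {j..d}" for q
  proof -
    have "q \<le> d" using q by simp
    from index_transposition[OF j this] obtain F
      where F0: "\<forall>m\<le>d. \<forall>x. b m (F x) = b (Transposition.transpose j q m) x"
        "\<forall>x. F (F x) = x" "scales_integral 1 F" by blast
    then have F: "b m (F x) = b (Transposition.transpose j q m) x" if "m \<le> d" for m x
      using that by blast
    have tr: "Transposition.transpose j q m \<in> {i..d}" if "m \<in> {i..d}" "i \<le> j" for m i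
      using that q by (auto simp: Transposition.transpose_def)
    have FR: "F x \<in> R j" if x: "x \<in> R j" for x
    proof -
      have "b m (F x) \<le> b i (F x)" if "i < j" "m \<in> {i..d}" for i m
      proof -
        have "Transposition.transpose j q i = i" using that q by (simp add: Transposition.transpose_def)
        then show ?thesis using x that j tr[of m i] by (auto simp: F R_def)
      qed
      moreover have "0 \<le> b m (F x)" if "m \<le> d" for m
        using x that tr[of m 0] by (auto simp: F R_def hull_iff)
      ultimately show ?thesis by (auto simp: R_def hull_iff)
    qed
    have FC: "F x \<in> C q" if "x \<in> C j" for x
      using that q FR tr[of _ j] by (auto simp: C_def F)
    have FC': "F x \<in> C j" if "x \<in> C q" for x
      using that q j FR tr[of _ j] by (auto simp: C_def F)
    have "F ` C j = C q"
      using FC FC' F0(2) by (auto simp: image_iff) metis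
    then have "integral (C q) g = integral (C j) (\<lambda>x. g (F x))"
      using scales_integralD[OF F0(3) cC[of j] g] j by simp
    also have "\<dots> = integral (C j) g"
      using inv[of q F] F q by (intro integral_cong) auto
    finally show ?thesis .
  qed
  \<comment> \<open>On an overlap both coordinates are maximal, hence equal, which confines it to a
    hyperplane.\<close>
  have neg: "negligible (C q \<inter> C q')" if "q \<in> {j..d}" "q' \<in> {j..d}" "q \<noteq> q'" for q q'
  proof (rule negligible_subset)
    show "negligible {x. bary K (e q) x = bary K (e q') x}"
      using that e_in e_eq_iff by (intro negligible_bary_level(2)[OF simplex]) auto
    show "C q \<inter> C q' \<subseteq> {x. bary K (e q) x = bary K (e q') x}"
      using that unfolding C_def b_def[symmetric] by (auto intro: order_antisym)
  qed
  have cov: "(\<Union>q\<in>{j..d}. C q) = R j"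
  proof
    show "R j \<subseteq> (\<Union>q\<in>{j..d}. C q)"
    proof
      fix x assume x: "x \<in> R j"
      have "Max ((\<lambda>m. b m x) ` {j..d}) \<in> (\<lambda>m. b m x) ` {j..d}"
        using j by (intro Max_in) auto
      then obtain q where q: "q \<in> {j..d}" "Max ((\<lambda>m. b m x) ` {j..d}) = b q x" by blast
      then have "x \<in> C q" using x by (auto simp: C_def simp flip: q(2))
      then show "x \<in> (\<Union>q\<in>{j..d}. C q)" using q by blast
    qed
  qed (auto simp: C_def)
  have "(g has_integral (\<Sum>q\<in>{j..d}. integral (C q) g)) (\<Union>q\<in>{j..d}. C q)"
    using neg compact_continuous_integral(1)[OF cC g]
    by (intro has_integral_UN) (auto simp: pairwise_def intro!: integrable_integral set_lebesgue_integral_eq_integral(1))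
  then have "integral (R j) g = (\<Sum>q\<in>{j..d}. integral (C q) g)"
    by (simp add: cov integral_unique)
  also have "\<dots> = (\<Sum>q\<in>{j..d}. integral (C j) g)" by (intro sum.cong eq refl)
  also have "\<dots> = (real d + 1 - real j) * integral (C j) g" using j by (simp add: of_nat_diff)
  also have "C j = R (Suc j)" by (simp add: C_def R_Suc)
  finally show ?thesis .
qed

lemma integral_b:
  assumes "m \<le> d"
  shows "integral (convex hull K) (b m) = simplex_volume K / (real d + 1)"
proof -
  have c: "compact (convex hull K)" by (rule compact_simplex[OF simplex])
  have eq: "integral (convex hull K) (b q) = integral (convex hull K) (b m)" if q: "q \<le> d" for q
  proof -
    from index_transposition[OF assms q] obtain F
      where F0: "\<forall>i\<le>d. \<forall>x. b i (F x) = b (Transposition.transpose m q i) x"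
        "\<forall>x. F (F x) = x" "scales_integral 1 F" by blast
    then have F: "b i (F x) = b (Transposition.transpose m q i) x" if "i \<le> d" for i x
      using that by blast
    have "F x \<in> convex hull K" if "x \<in> convex hull K" for x
      using that assms q by (auto simp: hull_iff F Transposition.transpose_def)
    then have "F ` (convex hull K) = convex hull K"
      using F0(2) by (auto simp: image_iff) metis
    then show ?thesis using scales_integralD[OF F0(3) c cont_b[OF q]] F[OF q] by simp
  qed
  have "simplex_volume K = integral (convex hull K) (\<lambda>x. \<Sum>q\<le>d. b q x)"
    by (simp add: sum_b simplex_volume_def)
  also have "\<dots> = (\<Sum>q\<le>d. integral (convex hull K) (b q))"
    using compact_continuous_integral(1)[OF c cont_b]
    by (intro integral_sum) (auto intro!: set_lebesgue_integral_eq_integral(1))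
  also have "\<dots> = (real d + 1) * integral (convex hull K) (b m)" using eq by simp
  finally show ?thesis by (simp add: field_simps)
qed


text \<open>The region is spanned by the centroids \<open>p m\<close> of the faces with vertices
  \<open>e 0, ..., e m\<close>, and \<open>F\<close> takes \<open>e m\<close> to \<open>p m\<close>.
  Since \<open>e 0\<close> lies in all these faces, \<open>b 0\<close> has the value
  \<open>1 / (m + 1)\<close> at \<open>p m\<close>.\<close>

lemma sorted_region_image:
  "\<exists>k F. F ` (convex hull K) = R (Suc d) \<and> scales_integral k F
     \<and> (\<forall>x. b 0 (F x) = (\<Sum>m\<le>d. b m x / (real m + 1)))"
proof -
  define p where "p m = (\<Sum>i\<le>m. (1 / (real m + 1)) *\<^sub>R e i)" for m
  define F where "F x = (\<Sum>v\<in>K. bary K v x *\<^sub>R p (the_inv_into {..d} e v))" for x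
  have "\<exists>k. scales_integral k F"
    using integral_simplex_map[OF simplex, of "\<lambda>v. p (the_inv_into {..d} e v)", folded F_def] .
  then obtain k where k: "scales_integral k F" ..
  have F: "F x = (\<Sum>m\<le>d. b m x *\<^sub>R p m)" for x
    unfolding F_def sum_K b_def using enum
    by (intro sum.cong refl) (auto simp: bij_betw_def the_inv_into_f_f)
  have be: "b i (e m) = (if i = m then 1 else 0)" if "i \<le> d" "m \<le> d" for i m
    using bary_vertex[OF simplex e_in e_in] that by (simp add: b_def e_eq_iff)
  have bp: "b i (p m) = (if i \<le> m then 1 / (real m + 1) else 0)" if "i \<le> d" "m \<le> d" for i m
  proof -
    have "b i (p m) = (\<Sum>l\<le>m. 1 / (real m + 1) * b i (e l))"
      unfolding p_def b_def using that by (intro bary_affine_combination[OF simplex e_in]) auto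
    also have "\<dots> = (\<Sum>l\<le>m. if i = l then 1 / (real m + 1) else 0)"
      using that by (intro sum.cong) (auto simp: be)
    finally show ?thesis by simp
  qed
  have bF: "b i (F x) = (\<Sum>m\<le>d. if i \<le> m then b m x / (real m + 1) else 0)" if "i \<le> d" for i x
  proof -
    have "b i (F x) = (\<Sum>m\<le>d. b m x * b i (p m))"
      unfolding F b_def[of i]
      by (rule bary_affine_combination[OF simplex e_in[OF that]]) (rule sum_b)
    also have "\<dots> = (\<Sum>m\<le>d. if i \<le> m then b m x / (real m + 1) else 0)"
      using that by (intro sum.cong) (auto simp: bp)
    finally show ?thesis .
  qed
  have "F x \<in> R (Suc d)" if x: "x \<in> convex hull K" for x
  proof -
    have "0 \<le> b m x" if "m \<le> d" for m using x that by (simp add: hull_iff)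
    then have "0 \<le> b i (F x)" "\<And>m. m \<in> {i..d} \<Longrightarrow> b m (F x) \<le> b i (F x)" if "i \<le> d" for i
      using that by (auto simp: bF intro!: sum_nonneg sum_mono)
    then show ?thesis by (auto simp: R_def hull_iff)
  qed
  moreover have "y \<in> F ` (convex hull K)" if y: "y \<in> R (Suc d)" for y
  proof -
    \<comment> \<open>Continuing the coordinates by 0 past \<open>d\<close> makes the last weight,
      \<open>(d + 1) * b d y\<close>, an instance of the general formula.\<close>
    define c where "c m = (if m \<le> d then b m y else 0)" for m
    \<comment> \<open>Solves \<open>F x = y\<close> for the coordinates of \<open>x\<close>: those
      of \<open>F x\<close> are the tail sums of \<open>\<mu> m / (m + 1)\<close>, so successive
      differences recover \<open>\<mu>\<close>. The ordering of the coordinates of \<open>y\<close>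
      makes the weights nonnegative.\<close>
    define \<mu> where "\<mu> m = (real m + 1) * (c m - c (Suc m))" for m
    have telescope: "(\<Sum>m\<le>n. \<mu> m) = (\<Sum>m\<le>n. c m) - (real n + 1) * c (Suc n)" for n
      by (induction n) (simp_all add: \<mu>_def algebra_simps)
    have "(\<Sum>m\<le>d. c m) = 1" using sum_b[of y] by (simp add: c_def)
    then have s1: "(\<Sum>m\<le>d. \<mu> m) = 1" by (simp add: telescope c_def)
    define x where "x = (\<Sum>m\<le>d. \<mu> m *\<^sub>R e m)"
    have bx: "b i x = \<mu> i" if "i \<le> d" for i
    proof -
      have "b i x = (\<Sum>m\<le>d. \<mu> m * b i (e m))"
        unfolding x_def b_def by (rule bary_affine_combination[OF simplex e_in[OF that] s1])
      also have "\<dots> = (\<Sum>m\<le>d. if i = m then \<mu> m else 0)"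
        using that by (intro sum.cong) (auto simp: be)
      finally show ?thesis using that by simp
    qed
    have "\<mu> m \<ge> 0" if "m \<le> d" for m
      using y that by (auto simp: \<mu>_def c_def R_def hull_iff)
    then have "x \<in> convex hull K" by (simp add: hull_iff bx)
    moreover have "F x = y"
    proof (rule b_determines)
      fix i assume i: "i \<le> d"
      have "b i (F x) = (\<Sum>m\<le>d. if i \<le> m then c m - c (Suc m) else 0)"
        unfolding bF[OF i] by (intro sum.cong) (auto simp: bx \<mu>_def)
      also have "\<dots> = (\<Sum>m\<in>{i..d}. c m - c (Suc m))"
        by (intro sum.mono_neutral_cong_right) auto
      also have "\<dots> = c i - c (Suc d)"
        using sum_Suc_diff[of i d "\<lambda>m. - c m"] i by simp
      finally show "b i (F x) = b i y" using i by (simp add: c_def)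
    qed
    ultimately show ?thesis by blast
  qed
  ultimately have "F ` (convex hull K) = R (Suc d)" by blast
  then show ?thesis using k bF[of 0] by (intro exI[of _ k] exI[of _ F]) simp
qed

text \<open>An affine function has as its mean the average of its vertex values; for the largest
  barycentric coordinate these values are \<open>1, 1/2, \<dots>, 1/(d + 1)\<close>.\<close>

lemma integral_sorted_region:
  "integral (R (Suc d)) (b 0) =
     (\<Sum>m\<le>d. 1 / (real m + 1)) / (real d + 1) * integral (R (Suc d)) (\<lambda>_. 1)"
proof -
  obtain k F where F: "F ` (convex hull K) = R (Suc d)" "scales_integral k F"
     "\<And>x. b 0 (F x) = (\<Sum>m\<le>d. b m x / (real m + 1))"
    using sorted_region_image by blast
  have c: "compact (convex hull K)" by (rule compact_simplex[OF simplex])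
  have "integral (R (Suc d)) (b 0) = k * integral (convex hull K) (\<lambda>x. \<Sum>m\<le>d. b m x / (real m + 1))"
    using scales_integralD[OF F(2) c cont_b[of 0]] by (simp add: F)
  also have "integral (convex hull K) (\<lambda>x. \<Sum>m\<le>d. b m x / (real m + 1))
      = (\<Sum>m\<le>d. integral (convex hull K) (\<lambda>x. b m x / (real m + 1)))"
    using compact_continuous_integral(1)[OF c cont_b]
    by (intro integral_sum integrable_on_divide) (auto intro!: set_lebesgue_integral_eq_integral(1))
  also have "\<dots> = (\<Sum>m\<le>d. simplex_volume K / (real d + 1) * (1 / (real m + 1)))"
    by (intro sum.cong) (simp_all add: integral_b)
  also have "\<dots> = simplex_volume K / (real d + 1) * (\<Sum>m\<le>d. 1 / (real m + 1))"
    by (rule sum_distrib_left[symmetric])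
  finally show ?thesis
    using scales_integralD[OF F(2) c, of "\<lambda>_. 1"] by (simp add: F simplex_volume_def)
qed

lemma measure_R_step:
  assumes "j \<le> d"
  shows "integral (R j) (\<lambda>_. 1 :: real) = (real d + 1 - real j) * integral (R (Suc j)) (\<lambda>_. 1)"
  by (rule integral_R_step[OF assms]) simp_all

lemma measure_R_pos: "j \<le> Suc d \<Longrightarrow> integral (R j) (\<lambda>_. 1 :: real) > 0"
proof (induction j)
  case 0
  then show ?case using simplex_volume_pos[OF simplex] by (simp add: R_0 simplex_volume_def)
next
  case (Suc j)
  then have "0 < (real d + 1 - real j) * integral (R (Suc j)) (\<lambda>_. 1 :: real)"
    using measure_R_step[of j] by simp
  then show ?case using Suc.prems by (simp add: zero_less_mult_iff)
qed

text \<open>The mean of the largest coordinate is the same on every \<open>R j\<close>: by symmetry, \<open>R j\<close> splits into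
  \<open>d + 1 - j\<close> congruent copies of \<open>R (Suc j)\<close>.\<close>

lemma mean_R:
  "j \<le> d \<Longrightarrow> integral (R 1) (b 0) * integral (R (Suc j)) (\<lambda>_. 1)
     = integral (R (Suc j)) (b 0) * integral (R 1) (\<lambda>_. 1)"
proof (induction j)
  case (Suc j)
  have "integral (R (Suc j)) (b 0) = (real d + 1 - real (Suc j)) * integral (R (Suc (Suc j))) (b 0)"
    using Suc.prems by (intro integral_R_step cont_b) (auto simp: Transposition.transpose_def)
  moreover have "integral (R (Suc j)) (\<lambda>_. 1 :: real) = (real d + 1 - real (Suc j)) * integral (R (Suc (Suc j))) (\<lambda>_. 1)"
    by (rule measure_R_step[OF Suc.prems])
  ultimately have "(real d + 1 - real (Suc j)) * (integral (R 1) (b 0) * integral (R (Suc (Suc j))) (\<lambda>_. 1))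
     = (real d + 1 - real (Suc j)) * (integral (R (Suc (Suc j))) (b 0) * integral (R 1) (\<lambda>_. 1))"
    using Suc by (simp add: mult.assoc mult.left_commute)
  moreover have "real d + 1 - real (Suc j) \<noteq> 0" using Suc.prems by linarith
  ultimately show ?case by (simp only: mult_cancel_left) blast
qed simp

lemma measure_R1: "integral (R 1) (\<lambda>_. 1) = simplex_volume K / (real d + 1)"
  using measure_R_step[of 0] by (simp add: R_0 simplex_volume_def field_simps)

lemma integral_R1: "integral (R 1) (b 0) = m1 d * simplex_volume K"
proof -
  let ?H = "\<Sum>m\<le>d. 1 / (real m + 1)"
  have "integral (R 1) (b 0) * integral (R (Suc d)) (\<lambda>_. 1)
     = ?H / (real d + 1) * (simplex_volume K / (real d + 1)) * integral (R (Suc d)) (\<lambda>_. 1)"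
    using mean_R[of d] integral_sorted_region measure_R1 by simp
  then have "integral (R 1) (b 0) = ?H / (real d + 1) * (simplex_volume K / (real d + 1))"
    by (rule mult_right_cancel[THEN iffD1, rotated]) (use measure_R_pos[of "Suc d"] in simp)
  \<comment> \<open>\<open>m1 d\<close> is the harmonic number of order \<open>d + 1\<close> over
    \<open>(d + 1)^2\<close>, one factor coming from the mean over the vertices and one from the
    volume of \<open>R 1\<close>. Its definition uses the sum up to \<open>d\<close>, so the last
    term is split off.\<close>
  also have "?H = (\<Sum>k=1..d. 1 / real k) + 1 / (real d + 1)"
  proof -
    have "?H = (\<Sum>k=1..Suc d. 1 / real k)"
      by (rule sum.reindex_bij_witness[of _ "\<lambda>k. k - 1" Suc]) auto
    then show ?thesis by simp
  qed
  finally show ?thesis by (simp add: m1_def field_simps power3_eq_cube)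
qed

end

subsection \<open>Dual cells inside one element\<close>

definition local_cell :: "(real^'n) set \<Rightarrow> real^'n \<Rightarrow> (real^'n) set" where
  "local_cell K P = {x \<in> convex hull K. \<forall>Q\<in>K. bary K Q x \<le> bary K P x}"

lemma compact_local_cell:
  assumes K: "is_simplex K" and P: "P \<in> K"
  shows "compact (local_cell K P)"
proof -
  have "local_cell K P = convex hull K \<inter> (\<Inter>Q\<in>K. {x. bary K Q x \<le> bary K P x})"
    by (auto simp: local_cell_def)
  moreover have "closed (\<Inter>Q\<in>K. {x. bary K Q x \<le> bary K P x})"
    using continuous_on_bary[OF K] P by (intro closed_INT ballI closed_Collect_le) auto
  ultimately show ?thesis using compact_simplex[OF K] by (simp add: compact_Int_closed)
qed

lemma local_cell_diag:
  fixes K :: "(real^'n) set"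
  assumes K: "is_simplex K" and P: "P \<in> K"
  shows "integral (local_cell K P) (\<lambda>_. 1) = simplex_volume K / (real CARD('n) + 1)"
    and "integral (local_cell K P) (bary K P) = m1 CARD('n) * simplex_volume K"
proof -
  have fin: "finite K" and card: "card K = Suc CARD('n)" using K by (auto simp: is_simplex_def)
  obtain h where h: "bij_betw h {..CARD('n)} K"
    using finite_same_card_bij[of "{..CARD('n)}" K] fin card by auto
  then obtain q where q: "q \<le> CARD('n)" "h q = P" using P by (auto simp: bij_betw_def)
  \<comment> \<open>Swapping 0 with the index of \<open>P\<close> gives \<open>P\<close> the number
    0, so that its cell becomes \<open>R 1\<close>.\<close>
  define e where "e = h \<circ> Transposition.transpose 0 q"
  have "bij_betw (Transposition.transpose 0 q) {..CARD('n)} {..CARD('n)}"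
    using q by simp
  then have e: "bij_betw e {..CARD('n)} K" unfolding e_def using h by (rule bij_betw_trans)
  have e0: "e 0 = P" by (simp add: e_def q)
  interpret enumerated_simplex K e "CARD('n)"
    using K e by unfold_locales
  have "local_cell K P = R 1"
    by (auto simp: local_cell_def R_def ball_K e0 b_def)
  moreover have "b 0 = bary K P" by (simp add: b_def e0)
  ultimately show "integral (local_cell K P) (\<lambda>_. 1) = simplex_volume K / (real CARD('n) + 1)"
    and "integral (local_cell K P) (bary K P) = m1 CARD('n) * simplex_volume K"
    using measure_R1 integral_R1 by simp_all
qed

text \<open>The row sum of the local matrix of an element of unit volume: the coordinates add up to
  1, and each vertex owns the share \<open>1 / (d + 1)\<close> of the element.\<close>

lemma m1_m2_sum: "d > 0 \<Longrightarrow> m1 d + real d * m2 d = 1 / (real d + 1)"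
proof -
  assume d: "d > 0"
  define H where "H = (\<Sum>k=1..d. 1 / real k)"
  have "real d * m2 d = ((real d)\<^sup>2 + 2 * real d - (real d + 1) * H) / (real d + 1) ^ 3"
    using d by (simp add: m2_def H_def)
  moreover have "m1 d = (1 + (real d + 1) * H) / (real d + 1) ^ 3"
    by (simp add: m1_def H_def)
  ultimately have "m1 d + real d * m2 d = (real d + 1)\<^sup>2 / (real d + 1) ^ 3"
    by (simp add: add_divide_distrib[symmetric] power2_eq_square algebra_simps)
  then show ?thesis by (simp add: power2_eq_square power3_eq_cube)
qed

text \<open>Transposing two vertices other than \<open>P\<close> preserves the cell of
  \<open>P\<close>, so the off-diagonal integrals coincide; together they make up the volume of the
  cell less the diagonal integral.\<close>

lemma local_cell_offdiag:
  fixes K :: "(real^'n) set"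
  assumes K: "is_simplex K" and P: "P \<in> K" and Q: "Q \<in> K" "Q \<noteq> P"
  shows "integral (local_cell K P) (bary K Q) = m2 CARD('n) * simplex_volume K"
proof -
  let ?C = "local_cell K P"
  have fin: "finite K" and card: "card K = Suc CARD('n)" using K by (auto simp: is_simplex_def)
  have c: "compact ?C" by (rule compact_local_cell[OF K P])
  have cb: "continuous_on UNIV (bary K V)" if "V \<in> K" for V using continuous_on_bary[OF K that] .
  have eq: "integral ?C (bary K V) = integral ?C (bary K Q)" if V: "V \<in> K - {P}" for V
  proof -
    obtain F where F: "\<forall>W\<in>K. \<forall>x. bary K W (F x) = bary K (Transposition.transpose Q V W) x"
      "\<forall>x. F (F x) = x" "scales_integral 1 F"
      using simplex_transposition[OF K Q(1), of V] V by blast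
    have t: "Transposition.transpose Q V W \<in> K" if "W \<in> K" for W
      using that Q V by (auto simp: Transposition.transpose_def)
    have tP: "Transposition.transpose Q V P = P" using Q V by (auto simp: Transposition.transpose_def)
    have "F x \<in> ?C" if "x \<in> ?C" for x
      using that t P F(1) by (auto simp: local_cell_def convex_hull_iff_bary[OF K] tP)
    then have "F ` ?C = ?C" using F(2) by (auto simp: image_iff) metis
    then show ?thesis
      using scales_integralD[OF F(3) c cb[of V]] V F(1) by simp
  qed
  have "simplex_volume K / (real CARD('n) + 1) = integral ?C (\<lambda>x. \<Sum>V\<in>K. bary K V x)"
    by (simp add: bary_sum[OF K] local_cell_diag[OF K P])
  also have "\<dots> = (\<Sum>V\<in>K. integral ?C (bary K V))"
    using compact_continuous_integral(1)[OF c cb] fin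
    by (intro integral_sum) (auto intro!: set_lebesgue_integral_eq_integral(1))
  also have "\<dots> = integral ?C (bary K P) + (\<Sum>V\<in>K - {P}. integral ?C (bary K V))"
    using fin P by (simp add: sum.remove)
  also have "(\<Sum>V\<in>K - {P}. integral ?C (bary K V)) = real CARD('n) * integral ?C (bary K Q)"
    using eq card P by simp
  finally have "real CARD('n) * integral ?C (bary K Q)
      = (1 / (real CARD('n) + 1) - m1 CARD('n)) * simplex_volume K"
    by (simp add: local_cell_diag[OF K P] algebra_simps)
  also have "\<dots> = real CARD('n) * (m2 CARD('n) * simplex_volume K)"
    by (simp add: m1_m2_sum[symmetric])
  finally show ?thesis by simp
qed

subsection \<open>Assembly over the mesh\<close>

lemma simplicial_meshD:
  assumes "simplicial_mesh T" "K \<in> T"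
  shows "is_simplex K" "finite K"
  using assms by (auto simp: simplicial_mesh_def is_simplex_def)

text \<open>Conformity puts \<open>x\<close> into the hull of the common vertices, and weights on
  those, extended by zero, serve as coordinates in both elements.\<close>

lemma bary_common_face:
  assumes T: "simplicial_mesh T" and K: "K \<in> T" "K' \<in> T"
    and x: "x \<in> convex hull K" "x \<in> convex hull K'" and Q: "Q \<in> K'"
  shows "bary K' Q x = (if Q \<in> K then bary K Q x else 0)"
proof -
  have "x \<in> convex hull (K \<inter> K')" using T K x by (auto simp: simplicial_mesh_def)
  moreover have fin: "finite K" "finite K'" using simplicial_meshD[OF T] K by auto
  ultimately obtain u where u: "sum u (K \<inter> K') = 1" "(\<Sum>v\<in>K \<inter> K'. u v *\<^sub>R v) = x"
    by (auto simp: convex_hull_finite)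
  let ?u = "\<lambda>v. if v \<in> K \<inter> K' then u v else 0"
  have s: "sum ?u L = 1" "(\<Sum>v\<in>L. ?u v *\<^sub>R v) = x" if "K \<inter> K' \<subseteq> L" "finite L" for L
  proof -
    have "sum ?u L = sum u (K \<inter> K')"
      using that by (intro sum.mono_neutral_cong_right) auto
    then show "sum ?u L = 1" by (simp add: u)
    have "(\<Sum>v\<in>L. ?u v *\<^sub>R v) = (\<Sum>v\<in>K \<inter> K'. u v *\<^sub>R v)"
      using that by (intro sum.mono_neutral_cong_right) auto
    then show "(\<Sum>v\<in>L. ?u v *\<^sub>R v) = x" by (simp add: u)
  qed
  have "bary K' Q x = ?u Q"
    using fin by (intro bary_eqI[OF simplicial_meshD(1)[OF T K(2)] _ _ Q] s) auto
  moreover have "bary K Q x = ?u Q" if "Q \<in> K"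
    using fin by (intro bary_eqI[OF simplicial_meshD(1)[OF T K(1)] _ _ that] s) auto
  ultimately show ?thesis by auto
qed

text \<open>\<open>hat\<close> picks an element by a choice operator; agreement of coordinates on
  common faces makes the value independent of that choice.\<close>

lemma hat_on_element:
  assumes T: "simplicial_mesh T" and K: "K \<in> T" and x: "x \<in> convex hull K"
  shows "hat T Q x = (if Q \<in> K then bary K Q x else 0)"
proof (cases "\<exists>L\<in>T. Q \<in> L \<and> x \<in> convex hull L")
  case True
  define L where "L = (SOME L. L \<in> T \<and> Q \<in> L \<and> x \<in> convex hull L)"
  have "\<exists>L. L \<in> T \<and> Q \<in> L \<and> x \<in> convex hull L" using True by blast
  then have L: "L \<in> T \<and> Q \<in> L \<and> x \<in> convex hull L"
    unfolding L_def by (rule someI_ex)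
  have "hat T Q x = bary L Q x" unfolding hat_def L_def using True by (rule if_P)
  then show ?thesis
    using bary_common_face[OF T K, of L x Q] x L by simp
next
  case False
  then show ?thesis using K x by (auto simp: hat_def)
qed

text \<open>Elements have equally many vertices, so one of \<open>K'\<close> is missing from
  \<open>K\<close>. Its coordinate vanishes on the intersection, which therefore lies in a
  hyperplane.\<close>

lemma negligible_element_Int:
  fixes T :: "(real^'n) set set"
  assumes T: "simplicial_mesh T" and K: "K \<in> T" "K' \<in> T" "K \<noteq> K'"
  shows "negligible (convex hull K \<inter> convex hull K')"
proof -
  have "card K = card K'" "finite K" "finite K'"
    using T K by (auto simp: simplicial_mesh_def is_simplex_def)
  then have "\<not> K' \<subseteq> K" using K(3) card_subset_eq by metis
  then obtain P where P: "P \<in> K'" "P \<notin> K" by blast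
  have "convex hull K \<inter> convex hull K' \<subseteq> {x. bary K' P x = 0}"
    using bary_common_face[OF T K(1,2) _ _ P(1)] P(2) by auto
  then show ?thesis
    using negligible_bary_level(1)[OF simplicial_meshD(1)[OF T K(2)] P(1)] negligible_subset by blast
qed

text \<open>The pieces of a dual cell overlap in null sets, so their integrals add. The sum is
  visibly symmetric in \<open>P\<close> and \<open>Q\<close>, unlike the definition.\<close>

lemma fvem_mass_assembly:
  fixes T :: "(real^'n) set set"
  assumes T: "simplicial_mesh T"
  shows "fvem_mass T P Q = (\<Sum>K\<in>T. if P \<in> K \<and> Q \<in> K then
           simplex_volume K * (if P = Q then m1 CARD('n) else m2 CARD('n)) else 0)"
proof -
  have finT: "finite T" using T by (simp add: simplicial_mesh_def)
  let ?S = "{K \<in> T. P \<in> K}"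
  let ?m = "\<lambda>K. if Q \<in> K then simplex_volume K * (if P = Q then m1 CARD('n) else m2 CARD('n)) else 0"
  have dc: "dual_cell T P = (\<Union>K\<in>?S. local_cell K P)"
    by (simp add: dual_cell_def local_cell_def)
  have hi: "(hat T Q has_integral ?m K) (local_cell K P)" if K: "K \<in> ?S" for K
  proof -
    have sK: "is_simplex K" using simplicial_meshD[OF T] K by blast
    have hat: "hat T Q x = (if Q \<in> K then bary K Q x else 0)" if "x \<in> local_cell K P" for x
      using that K by (intro hat_on_element[OF T]) (auto simp: local_cell_def)
    show ?thesis
    proof (cases "Q \<in> K")
      case True
      have "bary K Q absolutely_integrable_on local_cell K P"
        using K True by (intro compact_continuous_integral compact_local_cell[OF sK] continuous_on_bary[OF sK]) auto
      then have int: "(bary K Q has_integral integral (local_cell K P) (bary K Q)) (local_cell K P)"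
        by (intro integrable_integral set_lebesgue_integral_eq_integral(1))
      have "integral (local_cell K P) (bary K Q) = ?m K"
        using K True local_cell_diag(2)[OF sK, of P] local_cell_offdiag[OF sK, of P Q] by auto
      with int have "(bary K Q has_integral ?m K) (local_cell K P)" by (simp only:)
      then show ?thesis
        by (rule has_integral_eq[rotated]) (simp add: hat True)
    next
      case False
      have "((\<lambda>x. 0) has_integral 0) (local_cell K P)" by simp
      then show ?thesis using hat False by (simp cong: has_integral_cong)
    qed
  qed
  have neg: "negligible (local_cell K P \<inter> local_cell K' P)" if "K \<in> ?S" "K' \<in> ?S" "K \<noteq> K'" for K K'
    by (rule negligible_subset[OF negligible_element_Int[OF T, of K K']])
      (use that in \<open>auto simp: local_cell_def\<close>)
  have "(hat T Q has_integral (\<Sum>K\<in>?S. ?m K)) (\<Union>K\<in>?S. local_cell K P)"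
    using finT hi neg by (intro has_integral_UN) (auto simp: pairwise_def)
  then have "fvem_mass T P Q = (\<Sum>K\<in>?S. ?m K)"
    by (simp add: fvem_mass_def dc integral_unique)
  also have "\<dots> = (\<Sum>K\<in>T. if P \<in> K then ?m K else 0)"
    using finT by (simp add: sum.inter_filter)
  also have "\<dots> = (\<Sum>K\<in>T. if P \<in> K \<and> Q \<in> K then
           simplex_volume K * (if P = Q then m1 CARD('n) else m2 CARD('n)) else 0)"
    by (intro sum.cong) auto
  finally show ?thesis .
qed

subsection \<open>Spectral bounds\<close>

text \<open>A local matrix is \<open>\<alpha> - \<beta>\<close> times the identity plus
  \<open>\<beta>\<close> times the all-ones matrix. The two parts give the forms \<open>X\<close>
  and \<open>Y\<close>, with \<open>0 \<le> Y \<le> N * X\<close> by Cauchy-Schwarz. Summing over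
  \<open>I \<inter> K\<close> allows elements with vertices outside \<open>I\<close>.\<close>

lemma jacobi_assembled_eigenvalue_bounds:
  fixes M :: "'a \<Rightarrow> 'a \<Rightarrow> real" and T :: "'a set set" and V :: "'a set \<Rightarrow> real"
  assumes I: "finite I" and T: "finite T" and V: "\<And>K. K \<in> T \<Longrightarrow> V K > 0"
    and ab: "0 < \<alpha>" "0 \<le> \<beta>"
    and K: "\<And>K. K \<in> T \<Longrightarrow> finite K \<and> card K = N"
    and cover: "I \<subseteq> \<Union>T"
    and M: "\<And>i j. M i j = (\<Sum>K\<in>T. if i \<in> K \<and> j \<in> K then V K * (if i = j then \<alpha> else \<beta>) else 0)"
    and c: "c \<in> eigenvalues_on I (jacobi_scaled M)"
  shows "(\<alpha> - \<beta>) / \<alpha> \<le> c" "c \<le> (\<alpha> - \<beta> + real N * \<beta>) / \<alpha>"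
proof -
  obtain v where v: "\<exists>i\<in>I. v i \<noteq> 0" "\<And>i. i \<in> I \<Longrightarrow> (\<Sum>j\<in>I. jacobi_scaled M i j * v j) = c * v i"
    using c by (auto simp: eigenvalues_on_def)
  have D: "M i i > 0" if i: "i \<in> I" for i
  proof -
    obtain L where L: "L \<in> T" "i \<in> L" using cover i by blast
    show ?thesis unfolding M
      using L T V ab by (intro sum_pos2[of T L]) (auto intro: less_imp_le)
  qed
  \<comment> \<open>Turns the scaled problem into a generalized one: \<open>M\<close> applied to
    \<open>w\<close> is \<open>c\<close> times the diagonal part of \<open>M\<close> applied to
    \<open>w\<close>. Pairing with \<open>w\<close> then expresses \<open>c\<close> as a quotient of
    two sums over elements.\<close>
  define w where "w i = v i / sqrt (M i i)" for i
  have eig: "(\<Sum>j\<in>I. M i j * w j) = c * (M i i * w i)" if i: "i \<in> I" for i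
  proof -
    have "(\<Sum>j\<in>I. M i j * w j) = sqrt (M i i) * (\<Sum>j\<in>I. jacobi_scaled M i j * v j)"
      unfolding sum_distrib_left using D[OF i]
      by (intro sum.cong) (auto simp: jacobi_scaled_def w_def)
    also have "\<dots> = c * (sqrt (M i i) * v i)" using v(2)[OF i] by simp
    also have "sqrt (M i i) * v i = M i i * w i"
    proof -
      have "r = sqrt r * sqrt r" "sqrt r \<noteq> 0" if "r > 0" for r :: real using that by simp_all
      then show ?thesis unfolding w_def using D[OF i]
        by (metis (no_types, lifting) mult.assoc nonzero_mult_div_cancel_left times_divide_eq_right)
    qed
    finally show ?thesis .
  qed
  define X where "X K = (\<Sum>i\<in>I \<inter> K. (w i)\<^sup>2)" for K
  define Y where "Y K = (\<Sum>i\<in>I \<inter> K. w i)\<^sup>2" for K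
  define Z where "Z = (\<Sum>K\<in>T. V K * X K)"
  have restrict: "(\<Sum>i\<in>I. if i \<in> K then f i else 0) = (\<Sum>i\<in>I \<inter> K. f i)" for f :: "'a \<Rightarrow> real" and K
    using I by (simp add: sum.inter_restrict)
  have DZ: "(\<Sum>i\<in>I. M i i * (w i)\<^sup>2) = \<alpha> * Z"
  proof -
    have "(\<Sum>i\<in>I. M i i * (w i)\<^sup>2) = (\<Sum>i\<in>I. \<Sum>K\<in>T. if i \<in> K then V K * \<alpha> * (w i)\<^sup>2 else 0)"
      unfolding M sum_distrib_right by (intro sum.cong) auto
    also have "\<dots> = (\<Sum>K\<in>T. \<Sum>i\<in>I. if i \<in> K then V K * \<alpha> * (w i)\<^sup>2 else 0)" by (rule sum.swap)
    also have "\<dots> = \<alpha> * Z"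
      unfolding restrict Z_def X_def sum_distrib_left by (simp add: mult.assoc mult.left_commute)
    finally show ?thesis .
  qed
  have Mq: "(\<Sum>i\<in>I. w i * (\<Sum>j\<in>I. M i j * w j)) = (\<Sum>K\<in>T. V K * ((\<alpha> - \<beta>) * X K + \<beta> * Y K))"
  proof -
    have elem: "(\<Sum>i\<in>I. \<Sum>j\<in>I. if i \<in> K \<and> j \<in> K then V K * (if i = j then \<alpha> else \<beta>) * (w i * w j) else 0)
        = V K * ((\<alpha> - \<beta>) * X K + \<beta> * Y K)" for K
    proof -
      have "(\<Sum>i\<in>I. \<Sum>j\<in>I. if i \<in> K \<and> j \<in> K then V K * (if i = j then \<alpha> else \<beta>) * (w i * w j) else 0)
        = (\<Sum>i\<in>I. if i \<in> K then (\<Sum>j\<in>I. if j \<in> K then V K * (if i = j then \<alpha> else \<beta>) * (w i * w j) else 0) else 0)"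
        by (intro sum.cong) auto
      also have "\<dots> = (\<Sum>i\<in>I \<inter> K. \<Sum>j\<in>I \<inter> K. V K * (if i = j then \<alpha> else \<beta>) * (w i * w j))"
        unfolding restrict ..
      also have "\<dots> = (\<Sum>i\<in>I \<inter> K. \<Sum>j\<in>I \<inter> K. V K * ((\<alpha> - \<beta>) * (if i = j then (w i)\<^sup>2 else 0)) + V K * (\<beta> * (w i * w j)))"
        by (intro sum.cong refl) (simp add: algebra_simps power2_eq_square)
      also have "\<dots> = V K * ((\<alpha> - \<beta>) * (\<Sum>i\<in>I \<inter> K. \<Sum>j\<in>I \<inter> K. if i = j then (w i)\<^sup>2 else 0))
          + V K * (\<beta> * (\<Sum>i\<in>I \<inter> K. \<Sum>j\<in>I \<inter> K. w i * w j))"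
        by (simp only: sum.distrib sum_distrib_left)
      also have "(\<Sum>i\<in>I \<inter> K. \<Sum>j\<in>I \<inter> K. if i = j then (w i)\<^sup>2 else 0) = X K"
        using I by (simp add: X_def)
      also have "(\<Sum>i\<in>I \<inter> K. \<Sum>j\<in>I \<inter> K. w i * w j) = Y K"
        by (simp add: Y_def power2_eq_square sum_product)
      finally show ?thesis by (simp add: distrib_left)
    qed
    have "(\<Sum>i\<in>I. w i * (\<Sum>j\<in>I. M i j * w j))
      = (\<Sum>i\<in>I. \<Sum>j\<in>I. \<Sum>K\<in>T. if i \<in> K \<and> j \<in> K then V K * (if i = j then \<alpha> else \<beta>) * (w i * w j) else 0)"
      unfolding M sum_distrib_left sum_distrib_right by (intro sum.cong refl) auto
    also have "\<dots> = (\<Sum>i\<in>I. \<Sum>K\<in>T. \<Sum>j\<in>I. if i \<in> K \<and> j \<in> K then V K * (if i = j then \<alpha> else \<beta>) * (w i * w j) else 0)"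
      by (intro sum.cong refl sum.swap)
    also have "\<dots> = (\<Sum>K\<in>T. \<Sum>i\<in>I. \<Sum>j\<in>I. if i \<in> K \<and> j \<in> K then V K * (if i = j then \<alpha> else \<beta>) * (w i * w j) else 0)"
      by (rule sum.swap)
    finally show ?thesis unfolding elem .
  qed
  have cZ: "c * (\<alpha> * Z) = (\<Sum>K\<in>T. V K * ((\<alpha> - \<beta>) * X K + \<beta> * Y K))"
  proof -
    have "(\<Sum>i\<in>I. w i * (\<Sum>j\<in>I. M i j * w j)) = (\<Sum>i\<in>I. c * (M i i * (w i)\<^sup>2))"
      by (intro sum.cong refl) (simp add: eig power2_eq_square mult.left_commute)
    also have "\<dots> = c * (\<alpha> * Z)" by (simp add: DZ flip: sum_distrib_left)
    finally show ?thesis using Mq by simp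
  qed
  have "0 < (\<Sum>i\<in>I. M i i * (w i)\<^sup>2)"
  proof -
    obtain i where i: "i \<in> I" "v i \<noteq> 0" using v(1) by blast
    then have "w i \<noteq> 0" using D[of i] by (simp add: w_def)
    then have "0 < M i i * (w i)\<^sup>2" using D[OF i(1)] by (simp add: zero_less_mult_iff)
    then show ?thesis
      using i(1) I less_imp_le[OF D] by (intro sum_pos2[of I i]) simp_all
  qed
  then have Z: "Z > 0" using ab by (simp add: DZ zero_less_mult_iff)
  have XY: "0 \<le> Y K" "Y K \<le> real N * X K" if "K \<in> T" for K
  proof -
    show "0 \<le> Y K" by (simp add: Y_def)
    have "card (I \<inter> K) \<le> N" using K[OF that] card_mono[of K "I \<inter> K"] by simp
    moreover have "Y K \<le> X K * real (card (I \<inter> K))"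
      unfolding X_def Y_def by (rule sum_squared_le_sum_of_squares)
    moreover have "X K \<ge> 0" by (simp add: X_def sum_nonneg)
    ultimately show "Y K \<le> real N * X K"
      by (smt (verit, best) mult.commute mult_left_mono of_nat_mono)
  qed
  have scale: "r * Z = (\<Sum>K\<in>T. r * (V K * X K))" for r
    unfolding Z_def by (rule sum_distrib_left)
  have "(\<alpha> - \<beta>) * Z \<le> c * (\<alpha> * Z)"
    unfolding cZ unfolding scale
  proof (rule sum_mono)
    fix K assume "K \<in> T"
    then have "V K * (\<beta> * Y K) \<ge> 0" using V ab XY by (simp add: less_imp_le)
    then show "(\<alpha> - \<beta>) * (V K * X K) \<le> V K * ((\<alpha> - \<beta>) * X K + \<beta> * Y K)"
      by (simp add: algebra_simps)
  qed
  then have "(\<alpha> - \<beta>) * Z \<le> (c * \<alpha>) * Z" by (simp add: mult.assoc)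
  then have "\<alpha> - \<beta> \<le> c * \<alpha>" using Z by simp
  then show "(\<alpha> - \<beta>) / \<alpha> \<le> c" using ab by (simp add: pos_divide_le_eq)
  have "c * (\<alpha> * Z) \<le> (\<alpha> - \<beta> + real N * \<beta>) * Z"
    unfolding cZ unfolding scale
  proof (rule sum_mono)
    fix K assume "K \<in> T"
    then have "V K * (\<beta> * Y K) \<le> V K * (\<beta> * (real N * X K))"
      using V ab XY by (intro mult_left_mono) (auto intro: less_imp_le)
    then show "V K * ((\<alpha> - \<beta>) * X K + \<beta> * Y K) \<le> (\<alpha> - \<beta> + real N * \<beta>) * (V K * X K)"
      by (simp add: algebra_simps)
  qed
  then have "(c * \<alpha>) * Z \<le> (\<alpha> - \<beta> + real N * \<beta>) * Z" by (simp add: mult.assoc)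
  then have "c * \<alpha> \<le> \<alpha> - \<beta> + real N * \<beta>" using Z by simp
  then show "c \<le> (\<alpha> - \<beta> + real N * \<beta>) / \<alpha>" using ab by (simp add: pos_le_divide_eq)
qed

text \<open>With \<open>H\<close> the harmonic sum up to \<open>d\<close>, nonnegativity of
  \<open>m2\<close> comes from \<open>H \<le> d\<close> and the strict inequality from
  \<open>1 \<le> H\<close>.\<close>

lemma m1_m2_bounds:
  assumes "d > 0"
  shows "0 \<le> m2 d" "m2 d < m1 d"
proof -
  define H where "H = (\<Sum>k=1..d. 1 / real k)"
  have "H \<le> (\<Sum>k=1..d. 1)" unfolding H_def by (intro sum_mono) auto
  then have Hd: "H \<le> real d" by simp
  have "(\<Sum>k\<in>{1}. 1 / real k) \<le> H"
    unfolding H_def using assms by (intro sum_mono2) auto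
  then have H1: "1 \<le> H" by simp
  have "(real d + 1) * H \<le> (real d + 1) * real d" using Hd by (intro mult_left_mono) auto
  then have "0 \<le> (real d)\<^sup>2 + 2 * real d - (real d + 1) * H"
    by (simp add: algebra_simps power2_eq_square)
  then show "0 \<le> m2 d" by (simp add: m2_def H_def)
  have form: "m1 d = (1 + (real d + 1) * H) / (real d + 1) ^ 3"
    "m2 d = ((real d)\<^sup>2 + 2 * real d - (real d + 1) * H) / (real d * (real d + 1) ^ 3)"
    by (simp_all add: m1_def m2_def H_def)
  have "m1 d - m2 d = ((real d + 1)\<^sup>2 * H - real d * (real d + 1)) / (real d * (real d + 1) ^ 3)"
    unfolding form using assms by (simp add: field_simps power2_eq_square)
  moreover have "(real d + 1)\<^sup>2 * 1 \<le> (real d + 1)\<^sup>2 * H" using H1 by (intro mult_left_mono) auto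
  then have "(real d + 1)\<^sup>2 * H - real d * (real d + 1) > 0"
    by (simp add: power2_eq_square algebra_simps)
  ultimately have "m1 d - m2 d > 0" using assms by simp
  then show "m2 d < m1 d" by simp
qed

theorem mainTheorem14:
  fixes T :: "(real^'n) set set"
  assumes "simplicial_mesh T"
    and "interior_vertices T \<noteq> {}"
  shows "spectral_cond (interior_vertices T) (jacobi_scaled (fvem_mass T))
           \<le> 1 / ((m1 CARD('n) - m2 CARD('n)) * (real CARD('n) + 1))"
proof -
  let ?I = "interior_vertices T" and ?A = "jacobi_scaled (fvem_mass T)"
  let ?a = "m1 CARD('n)" and ?b = "m2 CARD('n)"
  let ?E = "eigenvalues_on ?I ?A"
  have T: "finite T" "\<And>K. K \<in> T \<Longrightarrow> is_simplex K"
    using assms(1) by (auto simp: simplicial_mesh_def)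
  have I: "finite ?I" "?I \<subseteq> \<Union>T"
    using T by (auto simp: interior_vertices_def is_simplex_def)
  have m: "0 \<le> ?b" "?b < ?a" using m1_m2_bounds[of "CARD('n)"] by auto
  have "fvem_mass T i j = fvem_mass T j i" for i j
    unfolding fvem_mass_assembly[OF assms(1)] by (intro sum.cong) auto
  then have sym: "?A i j = ?A j i" for i j
    by (simp add: jacobi_scaled_def)
  have fin: "finite ?E" "?E \<noteq> {}"
    using finite_eigenvalues_on[OF I(1)] eigenvalues_on_nonempty[OF I(1) assms(2)] sym by blast+
  have bounds: "(?a - ?b) / ?a \<le> c" "c \<le> 1 / ((real CARD('n) + 1) * ?a)" if "c \<in> ?E" for c
  proof -
    note * = jacobi_assembled_eigenvalue_bounds[where M="fvem_mass T" and V=simplex_volume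
        and N="Suc CARD('n)" and \<alpha>="?a" and \<beta>="?b", OF I(1) T(1) simplex_volume_pos[OF T(2)] _ m(1) _ I(2)
          fvem_mass_assembly[OF assms(1)] that]
    show "(?a - ?b) / ?a \<le> c" by (rule *(1)) (use m T(2) in \<open>auto simp: is_simplex_def\<close>)
    have "c \<le> (?a - ?b + real (Suc CARD('n)) * ?b) / ?a"
      by (rule *(2)) (use m T(2) in \<open>auto simp: is_simplex_def\<close>)
    also have "?a - ?b + real (Suc CARD('n)) * ?b = 1 / (real CARD('n) + 1)"
      using m1_m2_sum[of "CARD('n)"] by (simp add: algebra_simps)
    finally show "c \<le> 1 / ((real CARD('n) + 1) * ?a)" by simp
  qed
  have "spectral_cond ?I ?A = Max ?E / Min ?E" by (simp add: spectral_cond_def)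
  \<comment> \<open>The maximum and the minimum are themselves eigenvalues, so the bounds apply to
    them; the lower bound is positive because \<open>m2 < m1\<close>.\<close>
  also have "\<dots> \<le> (1 / ((real CARD('n) + 1) * ?a)) / ((?a - ?b) / ?a)"
    using bounds[OF Max_in[OF fin]] bounds[OF Min_in[OF fin]] m by (intro frac_le) auto
  also have "\<dots> = 1 / ((?a - ?b) * (real CARD('n) + 1))"
    using m by (simp add: divide_simps)
  finally show ?thesis .
qed

end
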